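(* Fix an integer $b\ge1$, let $\omega=e^{2\pi i/b}$ and let $T(z)=\sum_{n\ge1}n^{n-1}z^n/n!$. Let $C(z,w,q)=\sum_{m,n,k}C_{m,n,k}w^{bm}\frac{z^n}{n!}q^k$ and $RH(z,w,q)=\sum_{m,n,k}CRH_{m,n,k}w^{bm}\frac{z^n}{n!}q^k$ (defined below). Then, as formal power series in $z,w$, $$C(bz,w,q)=\frac{w^b(e^{bz}-e^{bzq})}{(1-q)(q^b-w^be^{bzq})}\cdot\frac{\prod_{j=0}^{b-1}\bigl(q-\frac{T(\omega^jzw)}{z}\bigr)}{\prod_{j=0}^{b-1}\bigl(1-\frac{T(\omega^jzw)}{z}\bigr)}$$ and $$RH(bz,w,q)=\frac1b\sum_{d=0}^{b-1}C\bigl(bz,w,\omega^dq^{1/b}\bigr)\sum_{p=0}^{b-1}\bigl(\omega^dq^{1/b}\bigr)^{-p}.$$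
   Context: For $m\ge1$, $n\ge1$ consider the $m^n$ assignments of hash addresses in $\{0,1,\dots,m-1\}$ to $n$ keys labelled $1,\dots,n$, together with a marked key $\bullet$ among them whose hash address is $0$. Let $X_i$ be the number of keys with hash address $i$. Let $V$ be the number of keys other than $\bullet$ with hash address $0$ whose label is smaller than that of $\bullet$. Let $Q$ be the overflow of the parking problem on buckets $1,\dots,m-1$ (capacity $b$ each): $Q'_0=0$, $Q'_i=\max(Q'_{i-1}+X_i-b,0)$ for $1\le i\le m-1$, and $Q=Q'_{m-1}$. Put $C=Q+V$ and $D=\lfloor C/b\rfloor$. (For $n\le bm$, $D$ is the displacement of $\bullet$ in the table built by linear probing with the Robin Hood heuristic, ties broken in favour of smaller labels, and $C$ is the number of keys that win over $\bullet$.) $C_{m,n,k}$ is the number of such (assignment, $\bullet$) pairs with $C=k$, and $CRH_{m,n,k}$ the number with $D=k$. In the formula, $q^{1/b}$ is any fixed $b$-th root; the right side does not depend on the choice. *)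

theory Defs
  imports Complex_Main "HOL-Library.FuncSet" "HOL-Computational_Algebra.Computational_Algebra"
begin

section \<open>The counting problem\<close>

definition occupancy :: "nat \<Rightarrow> (nat \<Rightarrow> nat) \<Rightarrow> nat \<Rightarrow> nat" where
  "occupancy n h i = card {x \<in> {1..n}. h x = i}"

text \<open>
  \<open>parking_overflow b n h i\<close> is \<open>Q'\<^sub>i\<close>; the truncated subtraction of naturals is the
  maximum with \<open>0\<close> in the recurrence.
\<close>

fun parking_overflow :: "nat \<Rightarrow> nat \<Rightarrow> (nat \<Rightarrow> nat) \<Rightarrow> nat \<Rightarrow> nat" where
  "parking_overflow b n h 0 = 0"
| "parking_overflow b n h (Suc i) = parking_overflow b n h i + occupancy n h (Suc i) - b"

definition smaller_rivals :: "(nat \<Rightarrow> nat) \<Rightarrow> nat \<Rightarrow> nat" where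
  "smaller_rivals h x = card {y \<in> {1..<x}. h y = 0}"

definition winners :: "nat \<Rightarrow> nat \<Rightarrow> nat \<Rightarrow> (nat \<Rightarrow> nat) \<Rightarrow> nat \<Rightarrow> nat" where
  "winners b m n h x = parking_overflow b n h (m - 1) + smaller_rivals h x"

definition rh_displacement :: "nat \<Rightarrow> nat \<Rightarrow> nat \<Rightarrow> (nat \<Rightarrow> nat) \<Rightarrow> nat \<Rightarrow> nat" where
  "rh_displacement b m n h x = winners b m n h x div b"

text \<open>Pairs of an assignment and a marked key; there are none if \<open>m = 0\<close> or \<open>n = 0\<close>.\<close>

definition marked_assignments :: "nat \<Rightarrow> nat \<Rightarrow> ((nat \<Rightarrow> nat) \<times> nat) set" where
  "marked_assignments m n =
     {(h, x). h \<in> {1..n} \<rightarrow>\<^sub>E {0..<m} \<and> x \<in> {1..n} \<and> h x = 0}"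

definition C_count :: "nat \<Rightarrow> nat \<Rightarrow> nat \<Rightarrow> nat \<Rightarrow> nat" where
  "C_count b m n k = card {(h, x) \<in> marked_assignments m n. winners b m n h x = k}"

definition CRH_count :: "nat \<Rightarrow> nat \<Rightarrow> nat \<Rightarrow> nat \<Rightarrow> nat" where
  "CRH_count b m n k = card {(h, x) \<in> marked_assignments m n. rh_displacement b m n h x = k}"

lemma finite_marked_assignments: "finite (marked_assignments m n)"
  by (rule finite_subset[of _ "({1..n} \<rightarrow>\<^sub>E {0..<m}) \<times> {1..n}"])
     (auto simp: marked_assignments_def intro!: finite_PiE)

text \<open>Hence the sum over \<open>k\<close> in \<open>trivariate_gf\<close> below is a finite one.\<close>

lemma finite_support_C_count: "finite {k. C_count b m n k \<noteq> 0}"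
proof (rule finite_subset)
  show "{k. C_count b m n k \<noteq> 0} \<subseteq> (\<lambda>(h, x). winners b m n h x) ` marked_assignments m n"
    unfolding C_count_def by (auto simp: card_eq_0_iff image_iff)
qed (simp add: finite_marked_assignments)

lemma finite_support_CRH_count: "finite {k. CRH_count b m n k \<noteq> 0}"
proof (rule finite_subset)
  show "{k. CRH_count b m n k \<noteq> 0}
          \<subseteq> (\<lambda>(h, x). rh_displacement b m n h x) ` marked_assignments m n"
    unfolding CRH_count_def by (auto simp: card_eq_0_iff image_iff)
qed (simp add: finite_marked_assignments)


section \<open>Formal power series in \<open>z\<close> and \<open>w\<close>\<close>

text \<open>
  The ring \<open>K[[z,w]]\<close> is the type \<open>'a fps fps\<close>, with \<open>z\<close> the outer and \<open>w\<close> the inner variable.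
  With this nesting the library division is the intended one both for division by \<open>z\<close> and for
  division by a series with non-zero constant term (lemmas \<open>divide_zvar\<close>, \<open>divide_unit\<close>).
\<close>

definition zvar :: "'a::field fps fps" where
  "zvar = fps_X"

definition wvar :: "'a::field fps fps" where
  "wvar = fps_const fps_X"

definition scalar :: "'a::field \<Rightarrow> 'a fps fps" where
  "scalar c = fps_const (fps_const c)"

text \<open>The embedding of \<open>K[[z]]\<close> into \<open>K[[z,w]]\<close>.\<close>

definition lift_z :: "'a::field fps \<Rightarrow> 'a fps fps" where
  "lift_z f = Abs_fps (\<lambda>n. fps_const (f $ n))"

lemma divide_zvar: "(zvar * f) / zvar = (f :: 'a::field fps fps)"
proof -
  have "inverse (1 :: 'a fps fps) = 1"
    by (rule fps_inverse_one') simp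
  then show ?thesis
    by (simp add: zvar_def fps_divide_def fps_X_unit_factor mult.commute[of fps_X])
      (simp add: fps_eq_iff)
qed

lemma divide_unit:
  fixes f g :: "'a::field fps fps"
  assumes "g $ 0 $ 0 \<noteq> 0"
  shows "(f / g) * g = f"
proof -
  have sub: "subdegree g = 0"
    using assms by (intro subdegree_eq_0) auto
  have "g $ 0 * inverse (g $ 0) = 1"
    using assms by (simp add: inverse_mult_eq_1')
  then have "g * inverse g = 1"
    unfolding fps_inverse_def by (rule fps_right_inverse)
  moreover have "f / g = f * inverse g"
    using sub by (simp add: fps_divide_def fps_unit_factor_def)
  ultimately show ?thesis
    by (simp add: mult.assoc mult.commute[of _ g])
qed

text \<open>
  The series with coefficients \<open>a m n k\<close> of \<open>w^(b * m) * z^n / n! * q^k\<close>, with \<open>q\<close> an element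
  of the coefficient field.
\<close>

definition trivariate_gf ::
  "nat \<Rightarrow> (nat \<Rightarrow> nat \<Rightarrow> nat \<Rightarrow> nat) \<Rightarrow> 'a::field_char_0 \<Rightarrow> 'a fps fps" where
  "trivariate_gf b a q = Abs_fps (\<lambda>n. Abs_fps (\<lambda>l.
     if b dvd l
     then (\<Sum>k | a (l div b) n k \<noteq> 0. of_nat (a (l div b) n k) * q ^ k) / fact n
     else 0))"

definition C_gf :: "nat \<Rightarrow> 'a::field_char_0 \<Rightarrow> 'a fps fps" where
  "C_gf b q = trivariate_gf b (C_count b) q"

definition RH_gf :: "nat \<Rightarrow> 'a::field_char_0 \<Rightarrow> 'a fps fps" where
  "RH_gf b q = trivariate_gf b (CRH_count b) q"

definition tree_series :: "'a::field_char_0 fps" where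
  "tree_series = Abs_fps (\<lambda>n. if n = 0 then 0 else of_nat (n ^ (n - 1)) / fact n)"


section \<open>The coefficient field\<close>

text \<open>
  The coefficient field is \<open>complex poly fract\<close>, the field of rational functions over the complex
  numbers in one indeterminate \<open>s\<close>. It contains \<open>s\<close> itself, which can be taken for \<open>q\<close> where no
  root of \<open>q\<close> is needed, and \<open>s ^ b\<close>, which is also transcendental and has the \<open>b\<close>-th roots
  \<open>omega b ^ d * s\<close>.
\<close>

instance fract :: ("{idom,ring_char_0}") field_char_0
proof
  show "inj (of_nat :: nat \<Rightarrow> 'a fract)"
    by (auto intro!: injI simp: of_nat_fract eq_fract)
qed

definition omega :: "nat \<Rightarrow> complex poly fract" where
  "omega b = to_fract [:exp (2 * of_real pi * \<i> / of_nat b):]"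

end

theory Submission
  imports Defs
begin

text \<open>
  The kernel method. Let \<open>\<Omega>(q)\<close> be the generating function of the overflow of \<open>M\<close> buckets, summed
  over \<open>M\<close> with weight \<open>w\<^sup>b\<^sup>M\<close>, after the substitution of \<open>b z\<close> for \<open>z\<close>. Splitting off the last
  bucket gives \<open>\<Omega>(q) (q\<^sup>b - w\<^sup>b exp (b z q)) = P(q)\<close> with \<open>P\<close> a polynomial in \<open>q\<close> of degree at most
  \<open>b\<close> over \<open>K[[z,w]]\<close> and \<open>P(1) = 1\<close>. This holds with any power series in place of \<open>q\<close>. Since
  \<open>T = z exp T\<close>, the \<open>b\<close> series \<open>Y\<^sub>j = T(\<omega>\<^sup>j z w) / z\<close> satisfy \<open>Y\<^sub>j = \<omega>\<^sup>j w exp (z Y\<^sub>j)\<close>, hence they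
  annihilate the left factor and are the roots of \<open>P\<close>, so that
  \<open>P(q) = \<Prod>\<^sub>j (q - Y\<^sub>j) / \<Prod>\<^sub>j (1 - Y\<^sub>j)\<close>. The bucket of the marked key contributes
  \<open>(exp (b z) - exp (b z q)) / (1 - q)\<close>, because the key is equally often of each rank in it. The
  displacement is read off from the number of winners by averaging over the \<open>b\<close>-th roots of unity.
\<close>

section \<open>Distributing keys into buckets\<close>

text \<open>A map into \<open>insert a B\<close> is the same as its fibre \<open>S\<close> over
  \<open>a\<close> together with a map from the other points into \<open>B\<close>. This is how a
  single bucket gets split off, both the last one and bucket \<open>0\<close>.\<close>

lemma sum_PiE_insert:
  fixes F :: "('k \<Rightarrow> 'c) \<Rightarrow> 'r::comm_monoid_add"
  assumes "finite A" "finite B" "a \<notin> B"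
  shows "(\<Sum>h\<in>A \<rightarrow>\<^sub>E insert a B. F h) =
    (\<Sum>S\<in>Pow A. \<Sum>g\<in>(A - S) \<rightarrow>\<^sub>E B. F (\<lambda>x. if x \<in> S then a else g x))"
proof -
  have "(\<Sum>S\<in>Pow A. \<Sum>g\<in>(A - S) \<rightarrow>\<^sub>E B. F (\<lambda>x. if x \<in> S then a else g x)) =
      (\<Sum>(S, g)\<in>(SIGMA S:Pow A. (A - S) \<rightarrow>\<^sub>E B). F (\<lambda>x. if x \<in> S then a else g x))"
    using assms by (subst sum.Sigma) (auto intro!: finite_PiE)
  also have "\<dots> = (\<Sum>h\<in>A \<rightarrow>\<^sub>E insert a B. F h)"
  proof (rule sum.reindex_bij_witness[where
        j = "\<lambda>(S, g) x. if x \<in> S then a else g x" and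
        i = "\<lambda>h. ({x \<in> A. h x = a}, restrict h (A - {x \<in> A. h x = a}))"])
    fix p assume p: "p \<in> (SIGMA S:Pow A. (A - S) \<rightarrow>\<^sub>E B)"
    obtain S g where pp: "p = (S, g)" by (cases p)
    have S: "S \<subseteq> A" and g: "g \<in> (A - S) \<rightarrow>\<^sub>E B" using p pp by auto
    have eq: "{x \<in> A. (if x \<in> S then a else g x) = a} = S"
      using S g assms(3) by (auto split: if_splits)
    show "(\<lambda>h. ({x \<in> A. h x = a}, restrict h (A - {x \<in> A. h x = a})))
        ((\<lambda>(S, g) x. if x \<in> S then a else g x) p) = p"
      using g unfolding pp prod.case eq by (auto simp: fun_eq_iff PiE_def extensional_def)
    show "(\<lambda>(S, g) x. if x \<in> S then a else g x) p \<in> A \<rightarrow>\<^sub>E insert a B"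
      unfolding pp prod.case using S g by (auto simp: PiE_iff extensional_def)
  next
    fix h assume h: "h \<in> A \<rightarrow>\<^sub>E insert a B"
    then show "(\<lambda>(S, g) x. if x \<in> S then a else g x)
        ({x \<in> A. h x = a}, restrict h (A - {x \<in> A. h x = a})) = h"
      by (auto simp: fun_eq_iff PiE_def extensional_def)
    show "({x \<in> A. h x = a}, restrict h (A - {x \<in> A. h x = a}))
        \<in> (SIGMA S:Pow A. (A - S) \<rightarrow>\<^sub>E B)"
      using h by (auto simp: PiE_def)
  qed auto
  finally show ?thesis ..
qed

lemma sum_Pow_card:
  fixes F :: "nat \<Rightarrow> 'r::semiring_1"
  assumes "finite A"
  shows "(\<Sum>S\<in>Pow A. F (card S)) = (\<Sum>i\<le>card A. of_nat (card A choose i) * F i)"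
proof -
  have "(\<Sum>S\<in>Pow A. F (card S)) = (\<Sum>i\<le>card A. \<Sum>S\<in>{S \<in> Pow A. card S = i}. F (card S))"
    using assms by (intro sum.group[symmetric]) (auto intro: card_mono)
  also have "\<dots> = (\<Sum>i\<le>card A. of_nat (card A choose i) * F i)"
    using n_subsets[OF assms] by (intro sum.cong) auto
  finally show ?thesis .
qed

text \<open>The overflow process for arbitrary arrival numbers: removing the keys of one bucket
  leaves a key set that is no longer of the form \<open>{1..n}\<close>, to which
  \<open>occupancy\<close> is tied.\<close>

fun queue :: "nat \<Rightarrow> (nat \<Rightarrow> nat) \<Rightarrow> nat \<Rightarrow> nat" where
  "queue b X 0 = 0"
| "queue b X (Suc i) = queue b X i + X (Suc i) - b"

lemma queue_cong: "(\<And>i. i \<in> {1..M} \<Longrightarrow> X i = Y i) \<Longrightarrow> queue b X M = queue b Y M"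
  by (induction M) auto

lemma parking_overflow_eq_queue: "parking_overflow b n h M = queue b (occupancy n h) M"
  by (induction M) auto

text \<open>The total of the weight \<open>\<phi>\<close> of the final overflow over all ways to put
  \<open>n\<close> keys into \<open>M\<close> buckets. The weight is a parameter because a last
  bucket with \<open>i\<close> keys replaces it by a shifted one.\<close>

fun overflow_sum :: "nat \<Rightarrow> (nat \<Rightarrow> 'r::comm_ring_1) \<Rightarrow> nat \<Rightarrow> nat \<Rightarrow> 'r" where
  "overflow_sum b \<phi> 0 n = (if n = 0 then \<phi> 0 else 0)"
| "overflow_sum b \<phi> (Suc M) n =
     (\<Sum>i\<le>n. of_nat (n choose i) * overflow_sum b (\<lambda>c. \<phi> (c + i - b)) M (n - i))"

text \<open>Induction on the number of buckets, with \<open>S\<close> the set of keys in the last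
  one. Both \<open>A\<close> and \<open>\<phi>\<close> vary, since the induction hypothesis is
  applied to \<open>A - S\<close> and to the shifted weight.\<close>

lemma sum_queue_eq_overflow_sum:
  assumes "finite A"
  shows "(\<Sum>h\<in>A \<rightarrow>\<^sub>E {1..M}. \<phi> (queue b (\<lambda>i. card {x \<in> A. h x = i}) M)) =
    overflow_sum b \<phi> M (card A)"
  using assms
proof (induction M arbitrary: A \<phi>)
  case 0
  then show ?case by (cases "A = {}") (auto simp: PiE_eq_empty_iff)
next
  case (Suc M)
  have "(\<Sum>h\<in>A \<rightarrow>\<^sub>E {1..Suc M}. \<phi> (queue b (\<lambda>i. card {x \<in> A. h x = i}) (Suc M))) =
      (\<Sum>S\<in>Pow A. \<Sum>g\<in>(A - S) \<rightarrow>\<^sub>E {1..M}. \<phi> (queue b (\<lambda>i. card {x \<in> A.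
        (if x \<in> S then Suc M else g x) = i}) (Suc M)))"
    using Suc.prems by (subst sum_PiE_insert[symmetric]) (auto simp: atLeastAtMostSuc_conv)
  also have "\<dots> = (\<Sum>S\<in>Pow A. \<Sum>g\<in>(A - S) \<rightarrow>\<^sub>E {1..M}.
      \<phi> (queue b (\<lambda>i. card {x \<in> A - S. g x = i}) M + card S - b))"
  proof (intro sum.cong refl)
    fix S g assume S: "S \<in> Pow A" and g: "g \<in> (A - S) \<rightarrow>\<^sub>E {1..M}"
    have g_le: "g x \<le> M" if "x \<in> A" "x \<notin> S" for x
      using g that by (auto simp: PiE_iff)
    have "{x \<in> A. (if x \<in> S then Suc M else g x) = Suc M} = S"
      using S g_le by (fastforce split: if_splits)
    moreover have "queue b (\<lambda>i. card {x \<in> A. (if x \<in> S then Suc M else g x) = i}) M =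
        queue b (\<lambda>i. card {x \<in> A - S. g x = i}) M"
      by (intro queue_cong arg_cong[where f = card]) auto
    ultimately show "\<phi> (queue b (\<lambda>i. card {x \<in> A. (if x \<in> S then Suc M else g x) = i}) (Suc M)) =
        \<phi> (queue b (\<lambda>i. card {x \<in> A - S. g x = i}) M + card S - b)"
      by simp
  qed
  also have "\<dots> = (\<Sum>S\<in>Pow A. overflow_sum b (\<lambda>c. \<phi> (c + card S - b)) M (card A - card S))"
  proof (intro sum.cong refl)
    fix S assume "S \<in> Pow A"
    then have "card (A - S) = card A - card S"
      using Suc.prems by (auto intro: card_Diff_subset finite_subset)
    then show "(\<Sum>g\<in>(A - S) \<rightarrow>\<^sub>E {1..M}.
        \<phi> (queue b (\<lambda>i. card {x \<in> A - S. g x = i}) M + card S - b)) =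
        overflow_sum b (\<lambda>c. \<phi> (c + card S - b)) M (card A - card S)"
      using Suc.IH[of "A - S" "\<lambda>c. \<phi> (c + card S - b)"] Suc.prems by simp
  qed
  also have "\<dots> = overflow_sum b \<phi> (Suc M) (card A)"
    using sum_Pow_card[OF Suc.prems,
        of "\<lambda>i. overflow_sum b (\<lambda>c. \<phi> (c + i - b)) M (card A - i)"] by simp
  finally show ?case .
qed

section \<open>Linearity of \<open>overflow_sum\<close> in the weight, and its recurrence for
  powers\<close>

lemma overflow_sum_add:
  "overflow_sum b (\<lambda>c. \<phi> c + \<psi> c) M n = overflow_sum b \<phi> M n + overflow_sum b \<psi> M n"
  by (induction M arbitrary: \<phi> \<psi> n) (auto simp: algebra_simps sum.distrib)

lemma overflow_sum_cmult:
  "overflow_sum b (\<lambda>c. a * \<phi> c) M n = a * overflow_sum b \<phi> M n"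
  by (induction M arbitrary: \<phi> n) (auto simp: algebra_simps sum_distrib_left)

lemma overflow_sum_zero: "overflow_sum b (\<lambda>c. 0) M n = 0"
  using overflow_sum_cmult[of b 0 "\<lambda>_. 0" M n] by simp

lemma overflow_sum_sum:
  "overflow_sum b (\<lambda>c. \<Sum>j\<in>J. \<phi> j c) M n = (\<Sum>j\<in>J. overflow_sum b (\<phi> j) M n)"
  by (induction J rule: infinite_finite_induct) (simp_all add: overflow_sum_zero overflow_sum_add)

text \<open>
  Correction for the truncated subtraction: the contribution of the tables in which \<open>c < b\<close> keys
  reach the last bucket, overflow from its predecessors included.
\<close>

definition underfull_sum :: "nat \<Rightarrow> nat \<Rightarrow> nat \<Rightarrow> nat \<Rightarrow> 'r::comm_ring_1" where
  "underfull_sum b M c n =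
     (\<Sum>i\<le>n. of_nat (n choose i) * overflow_sum b (\<lambda>k. if k + i = c then 1 else 0) M (n - i))"

text \<open>The factor \<open>y ^ b\<close> undoes the departure of \<open>b\<close> keys, except
  where truncation occurs. The corrections carry the factors \<open>y ^ b - y ^ c\<close>, which
  vanish at \<open>y = 1\<close>, and multiply sums that do not depend on \<open>y\<close>.\<close>

lemma overflow_sum_power_Suc:
  fixes y :: "'r::comm_ring_1"
  shows "y ^ b * overflow_sum b (\<lambda>c. y ^ c) (Suc M) n =
    (\<Sum>i\<le>n. of_nat (n choose i) * (y ^ i * overflow_sum b (\<lambda>c. y ^ c) M (n - i))) +
    (\<Sum>c<b. (y ^ b - y ^ c) * underfull_sum b M c n)"
proof -
  \<comment> \<open>For \<open>k + i < b\<close> the exponent is truncated to \<open>0\<close>, and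
    the one surviving term of the sum turns \<open>y ^ (k + i)\<close> into
    \<open>y ^ b\<close>.\<close>
  have split: "y ^ b * y ^ (k + i - b) =
      y ^ i * y ^ k + (\<Sum>c<b. (y ^ b - y ^ c) * (if k + i = c then 1 else 0))" for k i
  proof (cases "k + i < b")
    case True
    then show ?thesis by (simp add: if_distrib[where f = "\<lambda>x. _ * x"] power_add cong: if_cong)
  next
    case False
    then have "(\<Sum>c<b. (y ^ b - y ^ c) * (if k + i = c then 1 else 0)) = 0"
      by (intro sum.neutral) auto
    with False show ?thesis by (simp flip: power_add add: add.commute)
  qed
  have "y ^ b * overflow_sum b (\<lambda>c. y ^ c) (Suc M) n =
      (\<Sum>i\<le>n. of_nat (n choose i) * overflow_sum b (\<lambda>k. y ^ b * y ^ (k + i - b)) M (n - i))"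
    by (simp add: sum_distrib_left overflow_sum_cmult algebra_simps)
  also have "\<dots> = (\<Sum>i\<le>n. of_nat (n choose i) * (y ^ i * overflow_sum b (\<lambda>c. y ^ c) M (n - i))) +
      (\<Sum>i\<le>n. of_nat (n choose i) * (\<Sum>c<b. (y ^ b - y ^ c) *
        overflow_sum b (\<lambda>k. if k + i = c then 1 else 0) M (n - i)))"
    unfolding split
    by (simp only: overflow_sum_add overflow_sum_sum overflow_sum_cmult distrib_left sum.distrib)
  also have "(\<Sum>i\<le>n. of_nat (n choose i) * (\<Sum>c<b. (y ^ b - y ^ c) *
        overflow_sum b (\<lambda>k. if k + i = c then 1 else 0) M (n - i))) =
      (\<Sum>c<b. (y ^ b - y ^ c) * underfull_sum b M c n)"
    unfolding underfull_sum_def sum_distrib_left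
    by (subst sum.swap) (simp add: algebra_simps)
  finally show ?thesis .
qed

section \<open>Adic sums\<close>

text \<open>Convergence of the series of terms \<open>t ^ i * f i\<close> to \<open>x\<close> in the
  \<open>t\<close>-adic topology. The \<open>f i\<close> are arbitrary ring elements and may
  themselves involve \<open>t\<close>, as happens when \<open>q\<close> is replaced by a series in
  \<open>z\<close>.\<close>

definition adic_sum :: "'r::comm_ring_1 \<Rightarrow> (nat \<Rightarrow> 'r) \<Rightarrow> 'r \<Rightarrow> bool" where
  "adic_sum t f x \<longleftrightarrow> (\<forall>N. t ^ N dvd x - (\<Sum>i<N. t ^ i * f i))"

text \<open>The Hausdorff property of the \<open>t\<close>-adic topology, which makes limits
  unique.\<close>

definition adic_separated :: "'r::comm_ring_1 \<Rightarrow> bool" where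
  "adic_separated t \<longleftrightarrow> (\<forall>x. (\<forall>N. t ^ N dvd x) \<longrightarrow> x = 0)"

lemma adic_sum_add:
  assumes "adic_sum t f x" "adic_sum t g y"
  shows "adic_sum t (\<lambda>i. f i + g i) (x + y)"
  unfolding adic_sum_def
proof
  fix N
  have "t ^ N dvd (x - (\<Sum>i<N. t ^ i * f i)) + (y - (\<Sum>i<N. t ^ i * g i))"
    using assms by (auto simp: adic_sum_def)
  then show "t ^ N dvd x + y - (\<Sum>i<N. t ^ i * (f i + g i))"
    by (simp add: algebra_simps sum.distrib)
qed

lemma adic_sum_cmult:
  assumes "adic_sum t f x"
  shows "adic_sum t (\<lambda>i. a * f i) (a * x)"
  unfolding adic_sum_def
proof
  fix N
  have "t ^ N dvd a * (x - (\<Sum>i<N. t ^ i * f i))"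
    using assms by (auto simp: adic_sum_def)
  then show "t ^ N dvd a * x - (\<Sum>i<N. t ^ i * (a * f i))"
    by (simp add: algebra_simps sum_distrib_left)
qed

lemma adic_sum_sum:
  assumes "\<And>j. j \<in> J \<Longrightarrow> adic_sum t (f j) (x j)"
  shows "adic_sum t (\<lambda>i. \<Sum>j\<in>J. f j i) (\<Sum>j\<in>J. x j)"
  using assms
proof (induction J rule: infinite_finite_induct)
  case (insert j J)
  then have "adic_sum t (\<lambda>i. f j i + (\<Sum>j\<in>J. f j i)) (x j + (\<Sum>j\<in>J. x j))"
    by (intro adic_sum_add) simp_all
  then show ?case using insert.hyps by simp
qed (simp_all add: adic_sum_def)

lemma adic_sum_unique:
  assumes "adic_separated t" "adic_sum t f x" "adic_sum t f y"
  shows "x = y"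
proof -
  have "t ^ N dvd (x - (\<Sum>i<N. t ^ i * f i)) - (y - (\<Sum>i<N. t ^ i * f i))" for N
    using assms(2,3) unfolding adic_sum_def by (blast intro: dvd_diff)
  then have "t ^ N dvd x - y" for N
    by simp
  then have "x - y = 0"
    using assms(1) unfolding adic_separated_def by blast
  then show ?thesis by simp
qed

lemma adic_sum_shift:
  assumes "adic_separated t" "adic_sum t f x" "adic_sum t (\<lambda>i. f (Suc i)) y"
  shows "x = f 0 + t * y"
proof -
  have "t ^ N dvd x - f 0 - t * y" for N
  proof -
    have "t ^ Suc N dvd x - (\<Sum>i<Suc N. t ^ i * f i)"
      using assms(2) unfolding adic_sum_def by blast
    then have "t ^ N dvd x - (\<Sum>i<Suc N. t ^ i * f i)"
      by (rule dvd_trans[OF le_imp_power_dvd[OF le_SucI[OF order_refl]]])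
    moreover have "t ^ N dvd t * (y - (\<Sum>i<N. t ^ i * f (Suc i)))"
      using assms(3) by (auto simp: adic_sum_def)
    ultimately have "t ^ N dvd (x - (\<Sum>i<Suc N. t ^ i * f i)) - t * (y - (\<Sum>i<N. t ^ i * f (Suc i)))"
      by (rule dvd_diff)
    then show ?thesis
      by (simp add: sum.lessThan_Suc_shift algebra_simps sum_distrib_left del: sum.lessThan_Suc)
  qed
  then have "x - f 0 - t * y = 0"
    using assms(1) unfolding adic_separated_def by blast
  then show ?thesis by (simp add: algebra_simps)
qed

text \<open>In the product of the two partial sums the pairs with \<open>i + j < N\<close> form the
  partial sum of the Cauchy product; every other pair is divisible by \<open>t ^ N\<close>.\<close>

lemma adic_sum_mult:
  assumes "adic_sum t f x" "adic_sum t g y"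
  shows "adic_sum t (\<lambda>n. \<Sum>i\<le>n. f i * g (n - i)) (x * y)"
  unfolding adic_sum_def
proof
  fix N
  define F where "F = (\<Sum>i<N. t ^ i * f i)"
  define G where "G = (\<Sum>i<N. t ^ i * g i)"
  let ?h = "\<lambda>(i, j). (t ^ i * f i) * (t ^ j * g j)"
  let ?D = "{(i, j). i + j < N}"
  have D: "?D \<subseteq> {..<N} \<times> {..<N}" by auto
  have "F * G = (\<Sum>p\<in>{..<N} \<times> {..<N}. ?h p)"
    unfolding F_def G_def sum_product by (simp add: sum.cartesian_product)
  also have "\<dots> = (\<Sum>p\<in>{..<N} \<times> {..<N} - ?D. ?h p) + (\<Sum>p\<in>?D. ?h p)"
    using D by (intro sum.subset_diff) auto
  also have "(\<Sum>p\<in>?D. ?h p) = (\<Sum>n<N. t ^ n * (\<Sum>i\<le>n. f i * g (n - i)))"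
    unfolding sum.triangle_reindex sum_distrib_left
    by (intro sum.cong refl) (auto simp: algebra_simps simp flip: power_add)
  finally have FG: "F * G - (\<Sum>n<N. t ^ n * (\<Sum>i\<le>n. f i * g (n - i))) =
      (\<Sum>p\<in>{..<N} \<times> {..<N} - ?D. ?h p)" by simp
  have "t ^ N dvd ?h p" if "p \<in> {..<N} \<times> {..<N} - ?D" for p
  proof -
    obtain i j where p: "p = (i, j)" by (cases p)
    have "?h p = t ^ (i + j) * (f i * g j)" by (simp add: p algebra_simps power_add)
    moreover have "t ^ N dvd t ^ (i + j)" using that p by (intro le_imp_power_dvd) auto
    ultimately show ?thesis by simp
  qed
  then have 1: "t ^ N dvd F * G - (\<Sum>n<N. t ^ n * (\<Sum>i\<le>n. f i * g (n - i)))"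
    unfolding FG by (rule dvd_sum)
  have 2: "t ^ N dvd (x - F) * y" "t ^ N dvd F * (y - G)"
    using assms by (auto simp: adic_sum_def F_def G_def)
  have "x * y - S = (x - F) * y + (F * (y - G) + (F * G - S))" for S
    by (simp add: algebra_simps)
  then show "t ^ N dvd x * y - (\<Sum>n<N. t ^ n * (\<Sum>i\<le>n. f i * g (n - i)))"
    using dvd_add[OF 2(1) dvd_add[OF 2(2) 1]] by (rule ssubst)
qed

section \<open>The \<open>z\<close>-adic and \<open>w\<close>-adic topologies of
  \<open>K[[z,w]]\<close>\<close>

lemma zvar_power_mult_nth:
  "(zvar ^ N * (u :: 'a::field fps fps)) $ n = (if n < N then 0 else u $ (n - N))"
  by (simp add: zvar_def fps_X_power_mult_nth)

lemma zvar_power_dvd_iff: "zvar ^ N dvd (u :: 'a::field fps fps) \<longleftrightarrow> (\<forall>n<N. u $ n = 0)"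
proof
  assume "zvar ^ N dvd u"
  then show "\<forall>n<N. u $ n = 0"
    by (auto simp: zvar_def fps_X_power_mult_nth dvd_def)
next
  assume "\<forall>n<N. u $ n = 0"
  then have "u = zvar ^ N * fps_shift N u"
    by (auto simp: zvar_def fps_eq_iff fps_X_power_mult_nth)
  then show "zvar ^ N dvd u" by (rule dvdI)
qed

lemma wvar_power_mult_nth:
  "(wvar ^ N * (u :: 'a::field fps fps)) $ n $ l = (if l < N then 0 else u $ n $ (l - N))"
  by (simp add: wvar_def fps_const_power fps_X_power_mult_nth)

lemma wvar_power_dvd_iff:
  "wvar ^ N dvd (u :: 'a::field fps fps) \<longleftrightarrow> (\<forall>n. \<forall>l<N. u $ n $ l = 0)"
proof
  assume "wvar ^ N dvd u"
  then show "\<forall>n. \<forall>l<N. u $ n $ l = 0"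
    by (auto simp: wvar_power_mult_nth dvd_def)
next
  assume "\<forall>n. \<forall>l<N. u $ n $ l = 0"
  then have "u = wvar ^ N * Abs_fps (\<lambda>n. fps_shift N (u $ n))"
    by (auto simp: fps_eq_iff wvar_power_mult_nth)
  then show "wvar ^ N dvd u" by (rule dvdI)
qed

lemma adic_separated_zvar: "adic_separated (zvar :: 'a::field fps fps)"
  unfolding adic_separated_def zvar_power_dvd_iff by (auto simp: fps_eq_iff)

lemma adic_separated_wvar_power:
  assumes "b \<ge> 1"
  shows "adic_separated (wvar ^ b :: 'a::field fps fps)"
proof -
  have "x = 0" if "\<forall>N n l. l < b * N \<longrightarrow> x $ n $ l = 0" for x :: "'a fps fps"
  proof -
    have "x $ n $ l = 0" for n l
    proof -
      have "l < b * Suc l" using assms by (cases b) auto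
      then show ?thesis using that by blast
    qed
    then show ?thesis by (simp add: fps_eq_iff)
  qed
  then show ?thesis
    by (auto simp: adic_separated_def wvar_power_dvd_iff simp flip: power_mult)
qed

text \<open>The coefficient of \<open>z ^ n\<close> is the same in all partial sums that include the
  term with index \<open>n\<close>, so the limit can be read off there.\<close>

lemma adic_sum_zvar_exists: "\<exists>x. adic_sum zvar f (x :: 'a::field fps fps)"
proof
  let ?x = "Abs_fps (\<lambda>n. (\<Sum>i\<le>n. zvar ^ i * f i) $ n)"
  have "(\<Sum>i\<le>n. zvar ^ i * f i) $ n = (\<Sum>i<N. zvar ^ i * f i) $ n" if "n < N" for n N
    unfolding fps_sum_nth using that
    by (intro sum.mono_neutral_left) (auto simp: zvar_def fps_X_power_mult_nth)
  then show "adic_sum zvar f ?x"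
    by (simp add: adic_sum_def zvar_power_dvd_iff)
qed

lemma adic_sum_wvar_power_exists:
  assumes "b \<ge> 1"
  shows "\<exists>x. adic_sum (wvar ^ b) f (x :: 'a::field fps fps)"
proof
  let ?x = "Abs_fps (\<lambda>n. Abs_fps (\<lambda>l. (\<Sum>i\<le>l. (wvar ^ b) ^ i * f i) $ n $ l))"
  have "(\<Sum>i\<le>l. (wvar ^ b) ^ i * f i) $ n $ l = (\<Sum>i<N. (wvar ^ b) ^ i * f i) $ n $ l"
    if "l < b * N" for l n N
  proof -
    have large: "((wvar ^ b) ^ i * f i) $ n $ l = 0" if "l < b * i" for i
      using that by (simp add: wvar_power_mult_nth flip: power_mult)
    have 1: "((wvar ^ b) ^ i * f i) $ n $ l = 0" if "\<not> i \<le> l" for i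
    proof (rule large)
      have "1 * i \<le> b * i"
        using assms by (rule mult_le_mono1)
      with that show "l < b * i" by linarith
    qed
    have 2: "((wvar ^ b) ^ i * f i) $ n $ l = 0" if "\<not> i < N" for i
    proof (rule large)
      have "b * N \<le> b * i"
        using that by (intro mult_le_mono2) simp
      then show "l < b * i"
        using \<open>l < b * N\<close> by (rule order_less_le_trans[rotated])
    qed
    \<comment> \<open>Neither index range need contain the other, so both are compared with their
      union.\<close>
    have "(\<Sum>i\<le>l. ((wvar ^ b) ^ i * f i) $ n $ l) =
        (\<Sum>i\<in>{..l} \<union> {..<N}. ((wvar ^ b) ^ i * f i) $ n $ l)"
    proof (rule sum.mono_neutral_left)
      show "\<forall>i\<in>{..l} \<union> {..<N} - {..l}. ((wvar ^ b) ^ i * f i) $ n $ l = 0"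
      proof
        fix i assume "i \<in> {..l} \<union> {..<N} - {..l}"
        then show "((wvar ^ b) ^ i * f i) $ n $ l = 0" by (intro 1) blast
      qed
    qed simp_all
    also have "\<dots> = (\<Sum>i<N. ((wvar ^ b) ^ i * f i) $ n $ l)"
    proof (rule sum.mono_neutral_right)
      show "\<forall>i\<in>{..l} \<union> {..<N} - {..<N}. ((wvar ^ b) ^ i * f i) $ n $ l = 0"
      proof
        fix i assume "i \<in> {..l} \<union> {..<N} - {..<N}"
        then show "((wvar ^ b) ^ i * f i) $ n $ l = 0" by (intro 2) blast
      qed
    qed simp_all
    finally show ?thesis by (simp add: fps_sum_nth)
  qed
  then show "adic_sum (wvar ^ b) f ?x"
    by (simp add: adic_sum_def wvar_power_dvd_iff flip: power_mult)
qed

lemma adic_sum_zvarI: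
  assumes "\<And>n. f n = fps_const (x $ n)"
  shows "adic_sum zvar f (x :: 'a::field fps fps)"
proof -
  have "(\<Sum>i<N. zvar ^ i * f i) $ n = x $ n" if "n < N" for n N
  proof -
    have "(\<Sum>i<N. zvar ^ i * f i) $ n = (\<Sum>i<N. if n = i then x $ i else 0)"
      unfolding fps_sum_nth by (intro sum.cong refl) (simp add: assms zvar_def fps_X_power_mult_nth)
    then show ?thesis using that by simp
  qed
  then show ?thesis by (simp add: adic_sum_def zvar_power_dvd_iff)
qed

lemma lift_z_nth [simp]: "lift_z f $ n = fps_const (f $ n)"
  by (simp add: lift_z_def)

lemma adic_sum_lift_z: "adic_sum zvar (\<lambda>n. scalar (f $ n)) (lift_z f)"
  by (rule adic_sum_zvarI) (simp add: scalar_def)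

text \<open>The series \<open>y\<close> may have a constant term: \<open>zvar * y\<close> has none
  in \<open>z\<close>, so the composition is a genuine substitution.\<close>

lemma adic_sum_lift_z_compose:
  "adic_sum zvar (\<lambda>n. scalar (f $ n) * y ^ n) (lift_z f oo (zvar * y))"
proof -
  have "(lift_z f oo (zvar * y)) $ n = (\<Sum>i<N. zvar ^ i * (scalar (f $ i) * y ^ i)) $ n" if "n < N" for n N
  proof -
    have "(lift_z f oo (zvar * y)) $ n = (\<Sum>i\<le>n. (zvar ^ i * (scalar (f $ i) * y ^ i)) $ n)"
      unfolding fps_compose_nth atMost_atLeast0
    proof (intro sum.cong refl)
      fix i
      have "zvar ^ i * (scalar (f $ i) * y ^ i) = fps_const (fps_const (f $ i)) * (zvar * y) ^ i"
        by (simp only: scalar_def power_mult_distrib mult.left_commute)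
      then show "lift_z f $ i * ((zvar * y) ^ i) $ n = (zvar ^ i * (scalar (f $ i) * y ^ i)) $ n"
        by (simp only: fps_mult_left_const_nth lift_z_nth)
    qed
    also have "\<dots> = (\<Sum>i<N. (zvar ^ i * (scalar (f $ i) * y ^ i)) $ n)"
    proof (rule sum.mono_neutral_left)
      show "\<forall>i\<in>{..<N} - {..n}. (zvar ^ i * (scalar (f $ i) * y ^ i)) $ n = 0"
        by (simp add: zvar_power_mult_nth)
    qed (use that in auto)
    finally show ?thesis by (simp add: fps_sum_nth)
  qed
  then show ?thesis by (simp add: adic_sum_def zvar_power_dvd_iff)
qed

section \<open>The tree function\<close>

text \<open>Both sides come from the coefficient of \<open>x ^ k\<close> in
  \<open>(exp x - 1) ^ N\<close>: one by the binomial theorem, the other because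
  \<open>exp x - 1\<close> is \<open>x\<close> times a series with constant term
  \<open>1\<close>.\<close>

lemma alternating_binomial_sum_power:
  assumes "k \<le> N"
  shows "(\<Sum>n\<le>N. of_nat (N choose n) * (-1) ^ (N - n) * of_nat n ^ k) =
    (if k = N then fact N else (0 :: 'a::field_char_0))"
proof -
  let ?E = "fps_exp 1 - 1 :: 'a fps"
  have "?E ^ N = (\<Sum>n\<le>N. of_nat (N choose n) * fps_exp 1 ^ n * (- 1) ^ (N - n))"
    using binomial_ring[of "fps_exp 1" "- 1 :: 'a fps" N] by simp
  also have "\<dots> = (\<Sum>n\<le>N. fps_const (of_nat (N choose n) * (- 1) ^ (N - n)) * fps_exp (of_nat n))"
  proof (intro sum.cong refl)
    fix n
    have "(- 1) ^ (N - n) = fps_const ((- 1 :: 'a) ^ (N - n))"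
      by (metis fps_const_neg fps_const_power fps_const_1_eq_1)
    then show "of_nat (N choose n) * fps_exp 1 ^ n * (- 1) ^ (N - n) =
        fps_const (of_nat (N choose n) * (- 1) ^ (N - n)) * (fps_exp (of_nat n) :: 'a fps)"
      by (simp add: fps_exp_power_mult mult_ac flip: fps_of_nat fps_const_mult)
  qed
  finally have "(?E ^ N) $ k = (\<Sum>n\<le>N. of_nat (N choose n) * (-1) ^ (N - n) * of_nat n ^ k) / fact k"
    by (simp add: fps_sum_nth sum_divide_distrib)
  moreover have "(?E ^ N) $ k = (if k = N then 1 else 0)"
  proof -
    define h where "h = fps_shift 1 ?E"
    have "?E = fps_X * h"
      by (simp add: fps_eq_iff h_def)
    then have "?E ^ N = fps_X ^ N * h ^ N"
      by (simp add: power_mult_distrib)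
    moreover have "h $ 0 = 1"
      by (simp add: h_def)
    ultimately show ?thesis
      using assms by (simp add: fps_X_power_mult_nth fps_power_zeroth)
  qed
  ultimately show ?thesis by (auto simp: field_simps split: if_splits)
qed

text \<open>After multiplication by \<open>fact N\<close>, coefficient \<open>N\<close> becomes an
  alternating binomial sum of the powers \<open>n ^ (N - 1)\<close>, which vanishes because the
  exponent is below \<open>N\<close>.\<close>

lemma tree_series_compose_inverse:
  "tree_series oo (fps_X * fps_exp (- 1)) = (fps_X :: 'a::field_char_0 fps)"
proof (rule fps_ext)
  fix N
  have pow: "(fps_X * fps_exp (- 1)) ^ n = fps_X ^ n * (fps_exp (- of_nat n) :: 'a fps)" for n
    by (simp add: power_mult_distrib fps_exp_power_mult)
  have nth: "(tree_series oo (fps_X * fps_exp (- 1))) $ N =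
      (\<Sum>n\<le>N. tree_series $ n * (if N < n then 0 else (- of_nat n) ^ (N - n) / fact (N - n) :: 'a))"
    by (simp add: fps_compose_nth pow fps_X_power_mult_nth atLeast0AtMost)
  show "(tree_series oo (fps_X * fps_exp (- 1))) $ N = (fps_X :: 'a fps) $ N"
  proof (cases "N = 0")
    case True
    then show ?thesis by (simp add: tree_series_def)
  next
    case False
    have "fact N * (\<Sum>n\<le>N. tree_series $ n * (if N < n then 0 else (- of_nat n) ^ (N - n) / fact (N - n) :: 'a)) =
        (\<Sum>n\<le>N. of_nat (N choose n) * (-1) ^ (N - n) * (if n = 0 then 0 else of_nat n ^ (N - 1)))"
      unfolding sum_distrib_left
    proof (intro sum.cong refl)
      fix n assume n: "n \<in> {..N}"
      have p: "(of_nat n :: 'a) ^ (N - n) * of_nat n ^ (n - 1) = of_nat n ^ (N - 1)" if "n \<noteq> 0"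
        using n that by (simp flip: power_add)
      have m: "(- of_nat n :: 'a) ^ (N - n) = (-1) ^ (N - n) * of_nat n ^ (N - n)"
        by (rule power_minus)
      show "fact N * (tree_series $ n * (if N < n then 0 else (- of_nat n) ^ (N - n) / fact (N - n) :: 'a)) =
        of_nat (N choose n) * (-1) ^ (N - n) * (if n = 0 then 0 else of_nat n ^ (N - 1))"
        using n by (auto simp: tree_series_def binomial_fact m field_simps p[simplified])
    qed
    \<comment> \<open>The term \<open>n = 0\<close> is absent from the tree series, but
      \<open>0 ^ (N - 1)\<close> is \<open>1\<close> for \<open>N = 1\<close>; this correction
      yields the only nonzero coefficient.\<close>
    also have "\<dots> = (\<Sum>n\<le>N. of_nat (N choose n) * (-1) ^ (N - n) * of_nat n ^ (N - 1)) -
        (if N = 1 then -1 else 0)"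
      using False by (auto simp: sum.atMost_shift)
    also have "\<dots> = (if N = 1 then 1 else 0)"
      using False by (subst alternating_binomial_sum_power) auto
    finally show ?thesis unfolding nth by (auto split: if_splits)
  qed
qed

lemma tree_series_eq: "tree_series = fps_X * (fps_exp 1 oo (tree_series :: 'a::field_char_0 fps))"
proof -
  define f :: "'a fps" where "f = fps_X * fps_exp (- 1)"
  have f: "f $ 0 = 0" "f $ 1 \<noteq> 0" by (simp_all add: f_def)
  have inv0: "fps_inv f $ 0 = 0" by (simp add: fps_inv_def)
  have T0: "tree_series $ 0 = (0 :: 'a)" by (simp add: tree_series_def)
  \<comment> \<open>A left inverse of \<open>f\<close> under composition coincides with its right
    inverse \<open>fps_inv f\<close>.\<close>
  have "tree_series = tree_series oo (f oo fps_inv f)"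
    by (simp add: fps_inv_right[OF f])
  also have "\<dots> = fps_inv f"
    using tree_series_compose_inverse[where 'a = 'a] f(1)
    by (subst fps_compose_assoc) (simp_all add: inv0 flip: f_def)
  finally have "f oo tree_series = fps_X"
    using fps_inv_right[OF f] by (rule ssubst)
  then have "tree_series * (fps_exp (-1) oo tree_series) = (fps_X :: 'a fps)"
    by (simp add: f_def fps_compose_mult_distrib T0)
  moreover have "(fps_exp (-1) oo tree_series) * (fps_exp 1 oo tree_series) = (1 :: 'a fps)"
    by (simp add: T0 flip: fps_compose_mult_distrib fps_exp_add_mult)
  ultimately show ?thesis
    by (metis mult.assoc mult.right_neutral)
qed

section \<open>Transport to \<open>K[[z,w]]\<close> and the roots of the kernel\<close>

lemma lift_z_mult: "lift_z (f * g) = lift_z f * lift_z g"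
  by (simp add: fps_eq_iff fps_mult_nth fps_sum_nth)

lemma lift_z_power: "lift_z (f ^ n) = lift_z f ^ n"
  by (induction n) (simp_all add: lift_z_mult, simp add: fps_eq_iff)

lemma lift_z_compose: "lift_z (f oo g) = lift_z f oo lift_z g"
proof -
  have s: "fps_const (\<Sum>i\<in>I. h i) = (\<Sum>i\<in>I. fps_const (h i))" for I and h :: "nat \<Rightarrow> 'a"
    by (induction I rule: infinite_finite_induct) (auto simp flip: fps_const_add)
  show ?thesis
    by (simp add: fps_eq_iff fps_compose_nth s flip: lift_z_power)
qed

text \<open>This is \<open>Y\<^sub>j\<close> for \<open>c = omega b ^ j\<close>. The division is
  exact because \<open>tree_series\<close> has no constant term.\<close>

definition tree_root :: "'a::field_char_0 \<Rightarrow> 'a fps fps" where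
  "tree_root c = (lift_z tree_series oo (scalar c * zvar * wvar)) / zvar"

text \<open>Substituting \<open>c z w\<close> in \<open>T = X exp T\<close> exposes the factor
  \<open>zvar\<close> that the division removes.\<close>

lemma tree_root_eq: "tree_root c = scalar c * wvar * (lift_z (fps_exp 1) oo (zvar * tree_root c))"
proof -
  let ?v = "scalar c * zvar * wvar"
  have v0: "?v $ 0 = 0" by (simp add: scalar_def zvar_def wvar_def)
  have T0: "lift_z tree_series $ 0 = (0 :: 'a fps)" by (simp add: tree_series_def)
  have "lift_z (fps_X :: 'a fps) = fps_X" by (simp add: fps_eq_iff)
  then have "lift_z tree_series = fps_X * (lift_z (fps_exp 1) oo lift_z (tree_series :: 'a fps))"
    by (subst tree_series_eq) (simp add: lift_z_mult lift_z_compose)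
  then have "lift_z tree_series oo ?v = (fps_X * (lift_z (fps_exp 1) oo lift_z tree_series)) oo ?v"
    by (rule arg_cong)
  also have "\<dots> = ?v * (lift_z (fps_exp 1) oo (lift_z tree_series oo ?v))"
    by (simp only: fps_compose_mult_distrib[OF v0] fps_X_fps_compose_startby0[OF v0]
        fps_compose_assoc[OF v0 T0])
  finally have eq: "lift_z tree_series oo ?v =
      zvar * (scalar c * wvar * (lift_z (fps_exp 1) oo (lift_z tree_series oo ?v)))"
    by (simp add: mult_ac)
  then have root: "tree_root c = scalar c * wvar * (lift_z (fps_exp 1) oo (lift_z tree_series oo ?v))"
    unfolding tree_root_def by (metis divide_zvar)
  with eq have "zvar * tree_root c = lift_z tree_series oo ?v" by simp
  with root show "tree_root c = scalar c * wvar * (lift_z (fps_exp 1) oo (zvar * tree_root c))" by simp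
qed

lemma tree_root_nth_0: "tree_root c $ 0 = fps_const c * fps_X"
  by (subst tree_root_eq) (simp add: scalar_def wvar_def)

text \<open>Taking the \<open>b\<close>-th power eliminates \<open>c\<close>, so all
  \<open>b\<close> series annihilate the same kernel
  \<open>y\<^sup>b - w\<^sup>b exp (b z y)\<close>.\<close>

lemma tree_root_power:
  assumes "c ^ b = 1"
  shows "tree_root c ^ b = wvar ^ b * (lift_z (fps_exp (of_nat b)) oo (zvar * tree_root c))"
proof -
  have "tree_root c ^ b = scalar c ^ b * wvar ^ b * (lift_z (fps_exp 1) oo (zvar * tree_root c)) ^ b"
    by (subst tree_root_eq) (simp add: power_mult_distrib)
  also have "scalar c ^ b = (1 :: 'a fps fps)"
    by (simp add: scalar_def fps_const_power assms)
  also have "(lift_z (fps_exp 1) oo (zvar * tree_root c)) ^ b =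
      lift_z (fps_exp (of_nat b)) oo (zvar * tree_root c)"
    by (subst fps_compose_power) (simp_all add: zvar_def fps_exp_power_mult flip: lift_z_power)
  finally show ?thesis by simp
qed

section \<open>The kernel equation\<close>

lemma scalar_mult: "scalar (a * c) = scalar a * scalar c"
  by (simp add: scalar_def flip: fps_const_mult)

lemma scalar_power: "scalar (a ^ n) = scalar a ^ n"
  by (simp add: scalar_def fps_const_power)

lemma scalar_sum: "scalar (\<Sum>i\<in>I. f i) = (\<Sum>i\<in>I. scalar (f i))"
  by (induction I rule: infinite_finite_induct) (simp_all add: scalar_def flip: fps_const_add)

lemma scalar_of_nat: "scalar (of_nat k) = of_nat k"
  by (simp add: scalar_def fps_of_nat)

text \<open>The normalisation \<open>1 / fact n\<close> of an exponential generating function,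
  together with \<open>of_nat b ^ n\<close> from replacing \<open>z\<close> by
  \<open>b z\<close>.\<close>

definition exp_coeff :: "nat \<Rightarrow> nat \<Rightarrow> 'a::field_char_0 fps fps" where
  "exp_coeff b n = scalar (of_nat b ^ n / fact n)"

lemma exp_coeff_mult:
  assumes "i \<le> n"
  shows "exp_coeff b i * exp_coeff b (n - i) = of_nat (n choose i) * exp_coeff b n"
proof -
  have "(of_nat b ^ i / fact i) * (of_nat b ^ (n - i) / fact (n - i)) =
      of_nat (n choose i) * (of_nat b ^ n / fact n :: 'a)"
    using assms by (simp add: binomial_fact flip: power_add)
  then show ?thesis
    by (simp only: exp_coeff_def flip: scalar_mult scalar_of_nat)
qed

text \<open>Turns the Cauchy product of \<open>adic_sum_mult\<close> into the binomial convolution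
  that arises from distributing labelled keys.\<close>

lemma sum_exp_coeff_mult:
  "(\<Sum>i\<le>n. (exp_coeff b i * f i) * (exp_coeff b (n - i) * g (n - i))) =
    exp_coeff b n * (\<Sum>i\<le>n. of_nat (n choose i) * (f i * g (n - i)))"
  unfolding sum_distrib_left
proof (intro sum.cong refl)
  fix i assume "i \<in> {..n}"
  then have "exp_coeff b i * exp_coeff b (n - i) = of_nat (n choose i) * exp_coeff b n"
    by (intro exp_coeff_mult) simp
  then show "(exp_coeff b i * f i) * (exp_coeff b (n - i) * g (n - i)) =
      exp_coeff b n * (of_nat (n choose i) * (f i * g (n - i)))"
    by (metis (no_types, lifting) mult.assoc mult.commute mult.left_commute)
qed

text \<open>
  \<open>\<Omega>\<close> sums the overflows of all tables of \<open>M\<close> buckets, with weight \<open>wvar ^ (b * M)\<close>; \<open>y\<close> marks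
  the size of the overflow and may be any power series.
\<close>

definition is_overflow_gf :: "nat \<Rightarrow> 'a::field_char_0 fps fps \<Rightarrow> 'a fps fps \<Rightarrow> bool" where
  "is_overflow_gf b y \<Omega> \<longleftrightarrow> (\<exists>U.
     (\<forall>M. adic_sum zvar (\<lambda>n. exp_coeff b n * overflow_sum b (\<lambda>c. y ^ c) M n) (U M)) \<and>
     adic_sum (wvar ^ b) U \<Omega>)"

lemma is_overflow_gf_exists:
  assumes "b \<ge> 1"
  shows "\<exists>\<Omega>. is_overflow_gf b y \<Omega>"
proof -
  have "\<forall>M. \<exists>u. adic_sum zvar (\<lambda>n. exp_coeff b n * overflow_sum b (\<lambda>c. y ^ c) M n) u"
    by (rule allI) (rule adic_sum_zvar_exists)
  from choice[OF this] obtain U where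
    "\<forall>M. adic_sum zvar (\<lambda>n. exp_coeff b n * overflow_sum b (\<lambda>c. y ^ c) M n) (U M)" ..
  then show ?thesis
    using adic_sum_wvar_power_exists[OF assms, of U] unfolding is_overflow_gf_def by blast
qed

text \<open>The polynomial \<open>P\<close> is chosen before \<open>y\<close>: the underfull sums
  that form its coefficients do not depend on \<open>y\<close>. Hence one \<open>P\<close> serves
  for \<open>q\<close> and for all roots of the kernel.\<close>

lemma kernel_equation:
  assumes "b \<ge> 1"
  shows "\<exists>P :: 'a::field_char_0 fps fps poly. degree P \<le> b \<and> poly P 1 = 1 \<and>
    (\<forall>y E \<Omega>. adic_sum zvar (\<lambda>n. exp_coeff b n * y ^ n) E \<longrightarrow> is_overflow_gf b y \<Omega> \<longrightarrow>
      \<Omega> * (y ^ b - wvar ^ b * E) = poly P y)"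
proof -
  have "\<forall>M c. \<exists>a :: 'a fps fps. adic_sum zvar (\<lambda>n. exp_coeff b n * underfull_sum b M c n) a"
    using adic_sum_zvar_exists by blast
  then obtain a :: "nat \<Rightarrow> nat \<Rightarrow> 'a fps fps" where
    a: "\<And>M c. adic_sum zvar (\<lambda>n. exp_coeff b n * underfull_sum b M c n) (a M c)"
    by metis
  have "\<forall>c. \<exists>A. adic_sum (wvar ^ b) (\<lambda>M. a M c) A"
    using adic_sum_wvar_power_exists[OF assms] by blast
  then obtain A where A: "\<And>c. adic_sum (wvar ^ b) (\<lambda>M. a M c) (A c)"
    by metis
  define P where
    "P = monom 1 b + smult (wvar ^ b) (\<Sum>c<b. smult (A c) (monom 1 b - monom 1 c))"
  have poly_P: "poly P y = y ^ b + wvar ^ b * (\<Sum>c<b. (y ^ b - y ^ c) * A c)" for y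
    by (simp add: P_def poly_sum poly_monom mult.commute)
  show ?thesis
  proof (intro exI conjI allI impI)
    show "degree P \<le> b"
      unfolding P_def
      by (intro degree_add_le degree_smult_le[THEN order_trans] degree_sum_le degree_diff_le)
        (auto intro: degree_monom_le degree_monom_le[THEN order_trans])
    show "poly P 1 = 1"
      by (simp add: poly_P)
  next
    fix y E \<Omega> :: "'a fps fps"
    assume E: "adic_sum zvar (\<lambda>n. exp_coeff b n * y ^ n) E" and "is_overflow_gf b y \<Omega>"
    then obtain U where
      U: "\<And>M. adic_sum zvar (\<lambda>n. exp_coeff b n * overflow_sum b (\<lambda>c. y ^ c) M n) (U M)"
      and \<Omega>: "adic_sum (wvar ^ b) U \<Omega>"
      unfolding is_overflow_gf_def by blast
    \<comment> \<open>Without buckets only the empty key set can be distributed, with overflow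
      \<open>0\<close>.\<close>
    have U0: "U 0 = 1"
    proof (rule adic_sum_unique[OF adic_separated_zvar U])
      show "adic_sum zvar (\<lambda>n. exp_coeff b n * overflow_sum b (\<lambda>c. y ^ c) 0 n) 1"
        by (rule adic_sum_zvarI) (simp add: exp_coeff_def scalar_def)
    qed
    \<comment> \<open>The last bucket contributes the factor \<open>E\<close>, which stands for
      \<open>exp (b z y)\<close>; the remaining sum corrects for truncation.\<close>
    have rec: "y ^ b * U (Suc M) = E * U M + (\<Sum>c<b. (y ^ b - y ^ c) * a M c)" for M
    proof (rule adic_sum_unique[OF adic_separated_zvar])
      show "adic_sum zvar (\<lambda>n. y ^ b * (exp_coeff b n * overflow_sum b (\<lambda>c. y ^ c) (Suc M) n))
          (y ^ b * U (Suc M))"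
        by (rule adic_sum_cmult[OF U])
      have "y ^ b * (exp_coeff b n * overflow_sum b (\<lambda>c. y ^ c) (Suc M) n) =
          (\<Sum>i\<le>n. (exp_coeff b i * y ^ i) *
            (exp_coeff b (n - i) * overflow_sum b (\<lambda>c. y ^ c) M (n - i))) +
          (\<Sum>c<b. (y ^ b - y ^ c) * (exp_coeff b n * underfull_sum b M c n))" for n
      proof -
        have "y ^ b * (exp_coeff b n * overflow_sum b (\<lambda>c. y ^ c) (Suc M) n) =
            exp_coeff b n * (y ^ b * overflow_sum b (\<lambda>c. y ^ c) (Suc M) n)"
          by (rule mult.left_commute)
        also have "\<dots> = exp_coeff b n *
            (\<Sum>i\<le>n. of_nat (n choose i) * (y ^ i * overflow_sum b (\<lambda>c. y ^ c) M (n - i))) +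
            (\<Sum>c<b. (y ^ b - y ^ c) * (exp_coeff b n * underfull_sum b M c n))"
          unfolding overflow_sum_power_Suc distrib_left
          by (simp only: sum_distrib_left[of "exp_coeff b n" "\<lambda>c. (y ^ b - y ^ c) * _ c"]
              mult.left_commute[of "exp_coeff b n" "y ^ b - y ^ _"])
        finally show ?thesis
          unfolding sum_exp_coeff_mult .
      qed
      then show "adic_sum zvar (\<lambda>n. y ^ b * (exp_coeff b n * overflow_sum b (\<lambda>c. y ^ c) (Suc M) n))
          (E * U M + (\<Sum>c<b. (y ^ b - y ^ c) * a M c))"
        using adic_sum_add[OF adic_sum_mult[OF E U[of M]]
            adic_sum_sum[of "{..<b}", OF adic_sum_cmult[OF a[of M]]]]
        by presburger
    qed
    obtain \<Omega>' where \<Omega>': "adic_sum (wvar ^ b) (\<lambda>M. U (Suc M)) \<Omega>'"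
      using adic_sum_wvar_power_exists[OF assms] by blast
    have shift: "\<Omega> = 1 + wvar ^ b * \<Omega>'"
      using adic_sum_shift[OF adic_separated_wvar_power[OF assms] \<Omega> \<Omega>'] U0 by simp
    \<comment> \<open>The recurrence summed over \<open>M\<close>; together with
      \<open>shift\<close> it allows \<open>\<Omega>'\<close> to be eliminated.\<close>
    have "y ^ b * \<Omega>' = E * \<Omega> + (\<Sum>c<b. (y ^ b - y ^ c) * A c)"
    proof (rule adic_sum_unique[OF adic_separated_wvar_power[OF assms]])
      show "adic_sum (wvar ^ b) (\<lambda>M. y ^ b * U (Suc M)) (y ^ b * \<Omega>')"
        by (rule adic_sum_cmult[OF \<Omega>'])
      show "adic_sum (wvar ^ b) (\<lambda>M. y ^ b * U (Suc M)) (E * \<Omega> + (\<Sum>c<b. (y ^ b - y ^ c) * A c))"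
        unfolding rec
        by (intro adic_sum_add adic_sum_cmult[OF \<Omega>] adic_sum_sum adic_sum_cmult[OF A])
    qed
    then have "wvar ^ b * (y ^ b * \<Omega>') =
        wvar ^ b * (E * \<Omega>) + wvar ^ b * (\<Sum>c<b. (y ^ b - y ^ c) * A c)"
      by (simp only: distrib_left)
    moreover have "y ^ b * \<Omega> = y ^ b + wvar ^ b * (y ^ b * \<Omega>')"
      by (simp add: shift distrib_left mult.left_commute)
    ultimately show "\<Omega> * (y ^ b - wvar ^ b * E) = poly P y"
      unfolding poly_P by (simp add: algebra_simps)
  qed
qed

text \<open>Two polynomials of degree at most \<open>b\<close> that agree at the
  \<open>b + 1\<close> points \<open>1\<close> and \<open>Y j\<close> are equal. The normalisation
  at \<open>1\<close> fixes the leading coefficient without division.\<close>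

lemma poly_mult_prod_roots:
  fixes P :: "'r::idom poly"
  assumes "degree P \<le> b" "poly P 1 = 1" "inj_on Y {..<b}"
    and roots: "\<And>j. j < b \<Longrightarrow> poly P (Y j) = 0 \<and> Y j \<noteq> 1"
  shows "poly P q * (\<Prod>j<b. 1 - Y j) = (\<Prod>j<b. q - Y j)"
proof -
  let ?L = "smult (\<Prod>j<b. 1 - Y j) P" and ?R = "\<Prod>j<b. [:- Y j, 1:]"
  have poly_R: "poly ?R x = (\<Prod>j<b. x - Y j)" for x
    by (simp add: poly_prod)
  have "?L = ?R"
  proof (rule poly_eqI_degree)
    show "poly ?L x = poly ?R x" if x: "x \<in> insert 1 (Y ` {..<b})" for x
    proof (cases "x = 1")
      case True
      then show ?thesis by (simp add: poly_R assms(2))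
    next
      case False
      with x obtain j where j: "j < b" "x = Y j" by auto
      then have "(\<Prod>i<b. x - Y i) = 0" by (intro prod_zero) auto
      with j show ?thesis by (simp add: poly_R roots)
    qed
    have "1 \<notin> Y ` {..<b}" using roots by auto
    then have card: "card (insert 1 (Y ` {..<b})) = Suc b"
      using assms(3) by (simp add: card_image)
    show "degree ?L < card (insert 1 (Y ` {..<b}))"
      unfolding card using assms(1) degree_smult_le[of "\<Prod>j<b. 1 - Y j" P] by linarith
    show "degree ?R < card (insert 1 (Y ` {..<b}))"
      unfolding card by (simp add: degree_prod_eq_sum_degree)
  qed
  then have "poly ?L q = poly ?R q" by simp
  then show ?thesis by (simp add: poly_R mult.commute)
qed

section \<open>Counting the winners\<close>

text \<open>The ranks within \<open>S\<close> are \<open>0\<close> to \<open>card S - 1\<close>,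
  each taken once, so this is a geometric sum. The induction adds the largest element, which leaves
  the other ranks unchanged.\<close>

lemma one_minus_mult_sum_rank:
  fixes y :: "'r::comm_ring_1" and S :: "nat set"
  assumes "finite S"
  shows "(1 - y) * (\<Sum>x\<in>S. y ^ card {z \<in> S. z < x}) = 1 - y ^ card S"
  using assms
proof (induction rule: finite_linorder_max_induct)
  case (insert m S)
  have m: "m \<notin> S" and below_m: "{z \<in> insert m S. z < m} = S" using insert by auto
  have "{z \<in> insert m S. z < x} = {z \<in> S. z < x}" if "x \<in> S" for x
    using insert that by auto
  then have "(\<Sum>x\<in>S. y ^ card {z \<in> insert m S. z < x}) = (\<Sum>x\<in>S. y ^ card {z \<in> S. z < x})"
    by (intro sum.cong) simp_all
  then have "(\<Sum>x\<in>insert m S. y ^ card {z \<in> insert m S. z < x}) =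
      y ^ card S + (\<Sum>x\<in>S. y ^ card {z \<in> S. z < x})"
    by (simp only: sum.insert[OF insert(1) m] below_m)
  then show ?case
    using insert m by (simp only: distrib_left card_insert_disjoint) (simp add: algebra_simps)
qed simp

text \<open>For a fixed assignment, marking each key of bucket \<open>0\<close> in turn gives the
  geometric sum over ranks, while the overflow of the other \<open>M\<close> buckets depends only on
  the remaining keys.\<close>

lemma one_minus_mult_sum_winners:
  fixes y :: "'r::comm_ring_1"
  shows "(1 - y) * (\<Sum>(h, x)\<in>marked_assignments (Suc M) n. y ^ winners b (Suc M) n h x) =
    (\<Sum>i\<le>n. of_nat (n choose i) * ((1 - y ^ i) * overflow_sum b (\<lambda>c. y ^ c) M (n - i)))"
proof -
  let ?H = "{1..n} \<rightarrow>\<^sub>E {0..<Suc M}" and ?Z = "\<lambda>h. {x \<in> {1..n}. h x = (0::nat)}"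
  let ?q = "\<lambda>h. queue b (occupancy n h) M"
  have fin: "finite ?H" by (intro finite_PiE) auto
  have "marked_assignments (Suc M) n = Sigma ?H ?Z"
    by (auto simp: marked_assignments_def)
  then have "(1 - y) * (\<Sum>(h, x)\<in>marked_assignments (Suc M) n. y ^ winners b (Suc M) n h x) =
      (1 - y) * (\<Sum>h\<in>?H. \<Sum>x\<in>?Z h. y ^ winners b (Suc M) n h x)"
    using fin by (simp add: sum.Sigma)
  also have "\<dots> = (\<Sum>h\<in>?H. y ^ ?q h * ((1 - y) * (\<Sum>x\<in>?Z h. y ^ smaller_rivals h x)))"
    by (simp add: winners_def parking_overflow_eq_queue power_add sum_distrib_left mult.left_commute)
  also have "\<dots> = (\<Sum>h\<in>?H. y ^ ?q h * (1 - y ^ card (?Z h)))"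
  proof (intro sum.cong refl arg_cong[where f = "\<lambda>u. _ * u"])
    fix h
    have "(\<Sum>x\<in>?Z h. y ^ smaller_rivals h x) = (\<Sum>x\<in>?Z h. y ^ card {z \<in> ?Z h. z < x})"
      unfolding smaller_rivals_def by (intro sum.cong arg_cong[where f = "\<lambda>A. y ^ card A"]) auto
    then show "(1 - y) * (\<Sum>x\<in>?Z h. y ^ smaller_rivals h x) = 1 - y ^ card (?Z h)"
      using one_minus_mult_sum_rank[of "?Z h" y] by simp
  qed
  also have "{0..<Suc M} = insert 0 {1..M}" by auto
  also have "(\<Sum>h\<in>{1..n} \<rightarrow>\<^sub>E insert 0 {1..M}. y ^ ?q h * (1 - y ^ card (?Z h))) =
      (\<Sum>S\<in>Pow {1..n}. \<Sum>g\<in>({1..n} - S) \<rightarrow>\<^sub>E {1..M}.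
        (1 - y ^ card S) * y ^ queue b (\<lambda>i. card {x \<in> {1..n} - S. g x = i}) M)"
  proof (subst sum_PiE_insert; (intro sum.cong refl)?)
    fix S g assume S: "S \<in> Pow {1..n}" and g: "g \<in> ({1..n} - S) \<rightarrow>\<^sub>E {1..M}"
    let ?h = "\<lambda>x. if x \<in> S then 0 else g x"
    have "x \<in> S" if "x \<in> {1..n}" "g x = 0" for x
      using PiE_mem[OF g, of x] that by auto
    then have "?Z ?h = S" using S by (fastforce split: if_splits)
    moreover have "?q ?h = queue b (\<lambda>i. card {x \<in> {1..n} - S. g x = i}) M"
      unfolding occupancy_def by (intro queue_cong arg_cong[where f = card]) auto
    ultimately show "y ^ ?q ?h * (1 - y ^ card (?Z ?h)) =
        (1 - y ^ card S) * y ^ queue b (\<lambda>i. card {x \<in> {1..n} - S. g x = i}) M"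
      by (simp only: mult.commute)
  qed auto
  also have "\<dots> = (\<Sum>S\<in>Pow {1..n}. (1 - y ^ card S) * overflow_sum b (\<lambda>c. y ^ c) M (n - card S))"
  proof (intro sum.cong refl)
    fix S assume "S \<in> Pow {1..n}"
    then have "card ({1..n} - S) = n - card S"
      by (simp add: card_Diff_subset finite_subset)
    then show "(\<Sum>g\<in>({1..n} - S) \<rightarrow>\<^sub>E {1..M}.
        (1 - y ^ card S) * y ^ queue b (\<lambda>i. card {x \<in> {1..n} - S. g x = i}) M) =
        (1 - y ^ card S) * overflow_sum b (\<lambda>c. y ^ c) M (n - card S)"
      using sum_queue_eq_overflow_sum[of "{1..n} - S" "\<lambda>c. y ^ c" b M]
      by (simp flip: sum_distrib_left)
  qed
  also have "\<dots> = (\<Sum>i\<le>n. of_nat (n choose i) * ((1 - y ^ i) * overflow_sum b (\<lambda>c. y ^ c) M (n - i)))"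
    using sum_Pow_card[of "{1..n}" "\<lambda>i. (1 - y ^ i) * overflow_sum b (\<lambda>c. y ^ c) M (n - i)"] by simp
  finally show ?thesis .
qed

section \<open>From counts by value to sums over marked assignments\<close>

lemma sum_card_fibres:
  fixes F :: "'b \<Rightarrow> 'r::semiring_1"
  assumes "finite S"
  shows "(\<Sum>k | card {s \<in> S. f s = k} \<noteq> 0. of_nat (card {s \<in> S. f s = k}) * F k) = (\<Sum>s\<in>S. F (f s))"
proof -
  have "{k. card {s \<in> S. f s = k} \<noteq> 0} = f ` S"
    using assms by (auto simp: card_eq_0_iff)
  then have "(\<Sum>k | card {s \<in> S. f s = k} \<noteq> 0. of_nat (card {s \<in> S. f s = k}) * F k) =
      (\<Sum>k\<in>f ` S. \<Sum>s\<in>{s \<in> S. f s = k}. F (f s))"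
    by simp
  also have "\<dots> = (\<Sum>s\<in>S. F (f s))"
    using assms by (intro sum.group) auto
  finally show ?thesis .
qed

lemma compose_of_nat_zvar_nth:
  "(f oo (of_nat b * zvar)) $ n = of_nat b ^ n * (f $ n :: 'a::field_char_0 fps)"
  using fps_nth_compose_linear[of f "of_nat b" n] by (simp add: zvar_def fps_of_nat)

lemma trivariate_gf_compose_nth:
  assumes "\<And>m n k. a m n k = card {(h, x) \<in> marked_assignments m n. f m n h x = k}"
  shows "(trivariate_gf b a q oo (of_nat b * zvar)) $ n $ l = (if b dvd l then
    of_nat b ^ n / fact n * (\<Sum>(h, x)\<in>marked_assignments (l div b) n. q ^ f (l div b) n h x) else 0)"
proof -
  have split: "{(h, x) \<in> marked_assignments m n. f m n h x = k} =
      {p \<in> marked_assignments m n. (case p of (h, x) \<Rightarrow> f m n h x) = k}" for m k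
    by auto
  have "of_nat b ^ n = (fps_const (of_nat b ^ n) :: 'a fps)"
    by (simp add: fps_const_power flip: fps_of_nat)
  then show ?thesis
    using sum_card_fibres[OF finite_marked_assignments, of "l div b" n
        "\<lambda>(h, x). f (l div b) n h x" "\<lambda>k. q ^ k"]
    by (simp add: compose_of_nat_zvar_nth trivariate_gf_def assms split case_prod_unfold
        fps_mult_left_const_nth)
qed

lemmas C_gf_compose_nth =
  trivariate_gf_compose_nth[of "C_count b" "winners b" b, OF C_count_def, folded C_gf_def] for b

lemmas RH_gf_compose_nth =
  trivariate_gf_compose_nth[of "CRH_count b" "rh_displacement b" b, OF CRH_count_def,
    folded RH_gf_def, unfolded rh_displacement_def] for b

section \<open>The generating function of the winners\<close>

text \<open>Collects the series by powers of \<open>w\<^sup>b\<close>, so that the recurrences in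
  the number of buckets apply to it; only exponents of \<open>w\<close> divisible by
  \<open>b\<close> occur.\<close>

lemma adic_sum_C_gf:
  fixes q :: "'a::field_char_0"
  assumes "b \<ge> 1"
  defines "K \<equiv> \<lambda>m. Abs_fps (\<lambda>n. fps_const (of_nat b ^ n / fact n *
    (\<Sum>(h, x)\<in>marked_assignments m n. q ^ winners b m n h x)))"
  shows "adic_sum (wvar ^ b) K (C_gf b q oo (of_nat b * zvar))"
  unfolding adic_sum_def wvar_power_dvd_iff power_mult[symmetric]
proof (intro allI impI)
  fix N n l :: nat
  assume l: "l < b * N"
  have nth: "(wvar ^ (b * m) * K m) $ n $ l = (if l = b * m then of_nat b ^ n / fact n *
      (\<Sum>(h, x)\<in>marked_assignments m n. q ^ winners b m n h x) else 0)" for m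
    by (auto simp: wvar_power_mult_nth K_def)
  have "(\<Sum>m<N. wvar ^ (b * m) * K m) $ n $ l =
      (\<Sum>m<N. if l = b * m then of_nat b ^ n / fact n *
        (\<Sum>(h, x)\<in>marked_assignments m n. q ^ winners b m n h x) else 0)"
    by (simp add: fps_sum_nth nth)
  also have "\<dots> = (C_gf b q oo (of_nat b * zvar)) $ n $ l"
  proof (cases "b dvd l")
    case True
    then obtain t where t: "l = b * t" by (rule dvdE)
    have "t < N" using l t assms(1) by simp
    then show ?thesis using assms(1) by (simp add: C_gf_compose_nth t)
  next
    case False
    then have "l \<noteq> b * m" for m by auto
    then show ?thesis by (simp add: C_gf_compose_nth False)
  qed
  finally show "((C_gf b q oo (of_nat b * zvar)) - (\<Sum>m<N. wvar ^ (b * m) * K m)) $ n $ l = 0"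
    by simp
qed

text \<open>The difference of exponentials accounts for bucket \<open>0\<close> and its marked key,
  \<open>\<Omega>\<close> for the other \<open>m - 1\<close> buckets, and the extra
  \<open>wvar ^ b\<close> for the weight of bucket \<open>0\<close>.\<close>

lemma C_gf_eq_overflow_gf:
  fixes q :: "'a::field_char_0"
  assumes "b \<ge> 1"
    and "is_overflow_gf b (scalar q) \<Omega>"
  shows "(1 - scalar q) * (C_gf b q oo (of_nat b * zvar)) =
    wvar ^ b * ((lift_z (fps_exp (of_nat b)) - lift_z (fps_exp (of_nat b * q))) * \<Omega>)"
proof -
  obtain U where
    U: "\<And>M. adic_sum zvar (\<lambda>n. exp_coeff b n * overflow_sum b (\<lambda>c. scalar q ^ c) M n) (U M)"
    and \<Omega>: "adic_sum (wvar ^ b) U \<Omega>"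
    using assms(2) unfolding is_overflow_gf_def by blast
  define K where "K = (\<lambda>m. Abs_fps (\<lambda>n. fps_const (of_nat b ^ n / fact n *
    (\<Sum>(h, x)\<in>marked_assignments m n. q ^ winners b m n h x))))"
  let ?D = "lift_z (fps_exp (of_nat b)) - lift_z (fps_exp (of_nat b * q))"
  have K: "adic_sum (wvar ^ b) K (C_gf b q oo (of_nat b * zvar))"
    unfolding K_def by (rule adic_sum_C_gf) fact
  have "marked_assignments 0 n = {}" for n
    by (auto simp: marked_assignments_def)
  \<comment> \<open>Hence the series starts at \<open>m = 1\<close>, and shifting the index loses no
    term.\<close>
  then have K0: "K 0 = 0"
    by (simp add: K_def fps_eq_iff)
  have D: "adic_sum zvar (\<lambda>n. exp_coeff b n * (1 - scalar q ^ n)) ?D"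
  proof (rule adic_sum_zvarI)
    fix n
    show "exp_coeff b n * (1 - scalar q ^ n) = fps_const (?D $ n)"
      by (simp add: exp_coeff_def scalar_def fps_const_power power_mult_distrib algebra_simps
          flip: fps_const_1_eq_1 fps_const_sub)
  qed
  have KU: "(1 - scalar q) * K (Suc M) = ?D * U M" for M
  proof (rule adic_sum_unique[OF adic_separated_zvar])
    have "adic_sum zvar (\<lambda>n. exp_coeff b n *
        (\<Sum>(h, x)\<in>marked_assignments (Suc M) n. scalar q ^ winners b (Suc M) n h x)) (K (Suc M))"
    proof (rule adic_sum_zvarI)
      fix n
      have "(\<Sum>(h, x)\<in>marked_assignments (Suc M) n. scalar q ^ winners b (Suc M) n h x) =
          scalar (\<Sum>(h, x)\<in>marked_assignments (Suc M) n. q ^ winners b (Suc M) n h x)"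
        by (simp add: scalar_sum scalar_power case_prod_unfold)
      then show "exp_coeff b n *
          (\<Sum>(h, x)\<in>marked_assignments (Suc M) n. scalar q ^ winners b (Suc M) n h x) =
          fps_const (K (Suc M) $ n)"
        by (simp add: exp_coeff_def K_def scalar_def)
    qed
    from adic_sum_cmult[OF this, of "1 - scalar q"]
    show "adic_sum zvar (\<lambda>n. exp_coeff b n * (\<Sum>i\<le>n. of_nat (n choose i) *
        ((1 - scalar q ^ i) * overflow_sum b (\<lambda>c. scalar q ^ c) M (n - i)))) ((1 - scalar q) * K (Suc M))"
      by (simp only: mult.left_commute[of "1 - scalar q"] one_minus_mult_sum_winners)
    show "adic_sum zvar (\<lambda>n. exp_coeff b n * (\<Sum>i\<le>n. of_nat (n choose i) *
        ((1 - scalar q ^ i) * overflow_sum b (\<lambda>c. scalar q ^ c) M (n - i)))) (?D * U M)"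
      using adic_sum_mult[OF D U[of M]]
      unfolding sum_exp_coeff_mult[where f = "\<lambda>i. 1 - scalar q ^ i"
          and g = "overflow_sum b (\<lambda>c. scalar q ^ c) M"] .
  qed
  obtain C' where C': "adic_sum (wvar ^ b) (\<lambda>M. K (Suc M)) C'"
    using adic_sum_wvar_power_exists[OF assms(1)] by blast
  have "(1 - scalar q) * C' = ?D * \<Omega>"
  proof (rule adic_sum_unique[OF adic_separated_wvar_power[OF assms(1)]])
    show "adic_sum (wvar ^ b) (\<lambda>M. (1 - scalar q) * K (Suc M)) ((1 - scalar q) * C')"
      by (rule adic_sum_cmult[OF C'])
    show "adic_sum (wvar ^ b) (\<lambda>M. (1 - scalar q) * K (Suc M)) (?D * \<Omega>)"
      unfolding KU by (rule adic_sum_cmult[OF \<Omega>])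
  qed
  moreover have "C_gf b q oo (of_nat b * zvar) = wvar ^ b * C'"
    using adic_sum_shift[OF adic_separated_wvar_power[OF assms(1)] K C'] K0 by simp
  ultimately show ?thesis
    by (simp add: mult.left_commute)
qed

text \<open>The hypotheses on \<open>q\<close> make the denominators units, and those on
  \<open>c\<close> make it a primitive \<open>b\<close>-th root of unity, so that the
  \<open>b\<close> roots are distinct.\<close>

lemma C_gf_eq:
  fixes q c :: "'a::field_char_0"
  assumes "b \<ge> 1" "q \<noteq> 0" "q \<noteq> 1" "c ^ b = 1" "inj_on (\<lambda>j. c ^ j) {..<b}"
  shows "C_gf b q oo (of_nat b * zvar) =
    (wvar ^ b * (lift_z (fps_exp (of_nat b)) - lift_z (fps_exp (of_nat b * q))))
      / ((1 - scalar q) * (scalar q ^ b - wvar ^ b * lift_z (fps_exp (of_nat b * q))))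
    * ((\<Prod>j<b. scalar q - tree_root (c ^ j)) / (\<Prod>j<b. 1 - tree_root (c ^ j)))"
proof -
  obtain P :: "'a fps fps poly" where P: "degree P \<le> b \<and> poly P 1 = 1 \<and>
      (\<forall>y E \<Omega>. adic_sum zvar (\<lambda>n. exp_coeff b n * y ^ n) E \<longrightarrow> is_overflow_gf b y \<Omega> \<longrightarrow>
        \<Omega> * (y ^ b - wvar ^ b * E) = poly P y)"
    using kernel_equation[OF assms(1)] by (rule exE)
  then have kernel: "\<Omega> * (y ^ b - wvar ^ b * E) = poly P y"
    if "adic_sum zvar (\<lambda>n. exp_coeff b n * y ^ n) E" "is_overflow_gf b y \<Omega>" for y E \<Omega>
    using that by blast
  \<comment> \<open>At this \<open>y\<close> the kernel factor is zero by
    \<open>tree_root_power\<close>, and a series \<open>\<Omega>\<close> to multiply it with exists,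
    so the right side must vanish.\<close>
  have root: "poly P (tree_root (c ^ j)) = 0" for j
  proof -
    let ?y = "tree_root (c ^ j)"
    obtain \<Omega> where \<Omega>: "is_overflow_gf b ?y \<Omega>"
      using is_overflow_gf_exists[OF assms(1)] by blast
    have "adic_sum zvar (\<lambda>n. exp_coeff b n * ?y ^ n) (lift_z (fps_exp (of_nat b)) oo (zvar * ?y))"
      using adic_sum_lift_z_compose[of "fps_exp (of_nat b)" ?y] by (simp add: exp_coeff_def)
    from kernel[OF this \<Omega>] show ?thesis
      using tree_root_power[of "c ^ j" b] assms(4)
      by (simp add: power_mult[symmetric] mult.commute[of j]) (simp add: power_mult)
  qed
  \<comment> \<open>The coefficient of \<open>w\<close> separates the roots.\<close>
  have nth_0_1: "tree_root (c ^ j) $ 0 $ 1 = c ^ j" for j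
    by (simp add: tree_root_nth_0)
  have "inj_on (\<lambda>j. tree_root (c ^ j)) {..<b}"
    using assms(5) nth_0_1 unfolding inj_on_def by metis
  moreover have nth_0_0: "tree_root (c ^ j) $ 0 $ 0 = 0" for j
    by (simp add: tree_root_nth_0)
  then have "tree_root (c ^ j) \<noteq> 1" for j
    by (metis fps_one_nth zero_neq_one)
  ultimately have prod: "poly P (scalar q) * (\<Prod>j<b. 1 - tree_root (c ^ j)) =
      (\<Prod>j<b. scalar q - tree_root (c ^ j))"
    using P root by (intro poly_mult_prod_roots) auto
  obtain \<Omega> where \<Omega>: "is_overflow_gf b (scalar q) \<Omega>"
    using is_overflow_gf_exists[OF assms(1)] by blast
  define E where "E = lift_z (fps_exp (of_nat b * q))"
  have "adic_sum zvar (\<lambda>n. exp_coeff b n * scalar q ^ n) E"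
    using adic_sum_lift_z[of "fps_exp (of_nat b * q)"]
    by (simp add: exp_coeff_def E_def power_mult_distrib flip: scalar_mult scalar_power)
  note kernel_q = kernel[OF this \<Omega>]
  define D where "D = lift_z (fps_exp (of_nat b)) - E"
  have C: "(1 - scalar q) * (C_gf b q oo (of_nat b * zvar)) = wvar ^ b * (D * \<Omega>)"
    unfolding D_def E_def by (rule C_gf_eq_overflow_gf[OF assms(1) \<Omega>])
  define X where "X = (1 - scalar q) * (scalar q ^ b - wvar ^ b * E)"
  define Y where "Y = (\<Prod>j<b. 1 - tree_root (c ^ j))"
  define Z where "Z = (\<Prod>j<b. scalar q - tree_root (c ^ j))"
  \<comment> \<open>The constant term is \<open>(1 - q) * q ^ b\<close>: since
    \<open>b \<ge> 1\<close>, the term with \<open>wvar ^ b\<close> does not contribute.\<close>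
  have X: "X $ 0 $ 0 \<noteq> 0"
    using assms(1-3) by (simp add: X_def scalar_def wvar_def fps_const_power fps_X_power_nth)
  have "Y $ 0 $ 0 = 1"
    unfolding Y_def by (induction b) (simp_all add: nth_0_0)
  then have Y: "Y $ 0 $ 0 \<noteq> 0" by simp
  have "(C_gf b q oo (of_nat b * zvar)) * (X * Y) =
      ((1 - scalar q) * (C_gf b q oo (of_nat b * zvar))) * (scalar q ^ b - wvar ^ b * E) * Y"
    by (simp only: X_def mult_ac)
  also have "\<dots> = wvar ^ b * D * ((\<Omega> * (scalar q ^ b - wvar ^ b * E)) * Y)"
    unfolding C by (simp only: mult_ac)
  also have "\<dots> = (wvar ^ b * D) * Z"
    unfolding kernel_q Y_def Z_def prod ..
  also have "\<dots> = ((wvar ^ b * D) / X * X) * (Z / Y * Y)"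
    by (simp only: divide_unit[OF X] divide_unit[OF Y])
  also have "\<dots> = ((wvar ^ b * D) / X * (Z / Y)) * (X * Y)"
    by (simp only: mult_ac)
  finally have "(C_gf b q oo (of_nat b * zvar)) * (X * Y) = ((wvar ^ b * D) / X * (Z / Y)) * (X * Y)" .
  moreover have "X * Y \<noteq> 0" using X Y by auto
  ultimately have "C_gf b q oo (of_nat b * zvar) = (wvar ^ b * D) / X * (Z / Y)"
    using mult_right_cancel by blast
  then show ?thesis
    unfolding X_def Y_def Z_def D_def E_def .
qed

section \<open>Extracting the displacement\<close>

text \<open>Summing over \<open>d\<close> keeps only those \<open>p\<close> for which
  \<open>b\<close> divides \<open>k - p\<close>, hence just \<open>p = k mod b\<close>, and leaves
  \<open>r\<close> to the power \<open>k - k mod b\<close>.\<close>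

lemma roots_of_unity_filter:
  fixes c r :: "'a::field_char_0"
  assumes "b \<ge> 1" "c ^ b = 1" "inj_on (\<lambda>j. c ^ j) {..<b}" "r \<noteq> 0"
  shows "(\<Sum>d<b. (c ^ d * r) ^ k * (\<Sum>p<b. (c ^ d * r) powi (- int p))) = of_nat b * (r ^ b) ^ (k div b)"
proof -
  have c0: "c \<noteq> 0" using assms(1,2) by (auto simp: power_0_left)
  define s where "s = k mod b"
  have s: "s < b" using assms(1) by (simp add: s_def)
  have k: "k = b * (k div b) + s" by (simp add: s_def)
  have powi_power_swap: "(c powi i) ^ d = (c ^ d) powi i" for i d
    by (simp add: power_int_power power_int_power' mult.commute)
  have power_k: "(c ^ d * r) ^ k = (r ^ b) ^ (k div b) * (c ^ d * r) ^ s" for d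
  proof -
    have "(c ^ d * r) ^ k = ((c ^ d * r) ^ b) ^ (k div b) * (c ^ d * r) ^ s"
      by (subst k) (simp only: power_add power_mult)
    also have "(c ^ d * r) ^ b = (c ^ b) ^ d * r ^ b"
      by (simp only: power_mult_distrib mult.commute flip: power_mult)
    also have "\<dots> = r ^ b"
      using assms(2) by simp
    finally show ?thesis .
  qed
  have sum_powers: "(\<Sum>d<b. (c powi (int s - int p)) ^ d) = (if p = s then of_nat b else 0)" if "p < b" for p
  proof (cases "p = s")
    case False
    let ?x = "c powi (int s - int p)"
    have "?x \<noteq> 1"
    proof
      assume "?x = 1"
      then have "c ^ s = c ^ p"
        using c0 by (simp add: power_int_diff)
      then show False
        using assms(3) s that False by (auto dest: inj_onD)
    qed
    moreover have "?x ^ b = 1"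
      using assms(2) by (simp add: powi_power_swap)
    moreover have "(?x - 1) * (\<Sum>d<b. ?x ^ d) = ?x ^ b - 1"
      by (rule power_diff_1_eq[symmetric])
    ultimately show ?thesis using False by auto
  qed simp
  \<comment> \<open>Integer powers are used because \<open>s - p\<close> may be negative.\<close>
  have power_s: "(c ^ d * r) ^ s * (c ^ d * r) powi (- int p) =
      r powi (int s - int p) * (c powi (int s - int p)) ^ d" for d p
  proof -
    have "(c ^ d * r) ^ s * (c ^ d * r) powi (- int p) = (c ^ d * r) powi (int s - int p)"
      using c0 assms(4) by (simp add: power_int_diff power_int_minus field_simps)
    also have "\<dots> = r powi (int s - int p) * (c powi (int s - int p)) ^ d"
      by (simp add: power_int_mult_distrib powi_power_swap)
    finally show ?thesis .
  qed
  have "(\<Sum>d<b. (c ^ d * r) ^ k * (\<Sum>p<b. (c ^ d * r) powi (- int p))) =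
      (r ^ b) ^ (k div b) * (\<Sum>d<b. \<Sum>p<b. r powi (int s - int p) * (c powi (int s - int p)) ^ d)"
    by (simp add: power_k sum_distrib_left mult.assoc flip: power_s)
  also have "(\<Sum>d<b. \<Sum>p<b. r powi (int s - int p) * (c powi (int s - int p)) ^ d) =
      (\<Sum>p<b. r powi (int s - int p) * (\<Sum>d<b. (c powi (int s - int p)) ^ d))"
    unfolding sum_distrib_left by (rule sum.swap)
  also have "\<dots> = (\<Sum>p<b. if p = s then of_nat b else 0)"
    by (intro sum.cong refl) (simp add: sum_powers)
  also have "\<dots> = of_nat b"
    using s by simp
  finally show ?thesis by (simp add: mult.commute)
qed

lemma scalar_mult_nth: "(scalar a * f) $ n $ l = a * f $ n $ l"
  by (simp add: scalar_def)

text \<open>The filter is applied to each marked assignment separately, with \<open>k\<close> its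
  number of winners; \<open>k div b\<close> is then its displacement.\<close>

lemma RH_gf_eq:
  fixes c r :: "'a::field_char_0"
  assumes "b \<ge> 1" "c ^ b = 1" "inj_on (\<lambda>j. c ^ j) {..<b}" "r \<noteq> 0"
  shows "RH_gf b (r ^ b) oo (of_nat b * zvar) = scalar (1 / of_nat b) *
    (\<Sum>d<b. (C_gf b (c ^ d * r) oo (of_nat b * zvar)) * (\<Sum>p<b. scalar ((c ^ d * r) powi (- int p))))"
proof (intro fps_ext)
  fix n l
  let ?m = "l div b" and ?a = "of_nat b ^ n / fact n :: 'a"
  let ?A = "marked_assignments ?m n" and ?w = "\<lambda>p. winners b ?m n (fst p) (snd p)"
  let ?S = "\<lambda>d. \<Sum>p<b. (c ^ d * r) powi (- int p)"
  have "(scalar (1 / of_nat b) * (\<Sum>d<b. (C_gf b (c ^ d * r) oo (of_nat b * zvar)) *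
      (\<Sum>p<b. scalar ((c ^ d * r) powi (- int p))))) $ n $ l =
      1 / of_nat b * (\<Sum>d<b. ?S d * (C_gf b (c ^ d * r) oo (of_nat b * zvar)) $ n $ l)"
    by (simp only: scalar_mult_nth fps_sum_nth mult.commute[of "C_gf b _ oo _"] scalar_sum[symmetric])
  also have "\<dots> = (RH_gf b (r ^ b) oo (of_nat b * zvar)) $ n $ l"
  proof (cases "b dvd l")
    case True
    have "(\<Sum>d<b. ?S d * (?a * (\<Sum>p\<in>?A. (c ^ d * r) ^ ?w p))) =
        (\<Sum>d<b. \<Sum>p\<in>?A. ?a * ((c ^ d * r) ^ ?w p * ?S d))"
      unfolding sum_distrib_left[of _ _ ?A] by (simp only: mult_ac)
    also have "\<dots> = (\<Sum>p\<in>?A. ?a * (\<Sum>d<b. (c ^ d * r) ^ ?w p * ?S d))"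
      unfolding sum_distrib_left[of ?a] by (rule sum.swap)
    also have "\<dots> = of_nat b * (?a * (\<Sum>p\<in>?A. (r ^ b) ^ (?w p div b)))"
      unfolding roots_of_unity_filter[OF assms] by (simp add: sum_distrib_left mult_ac)
    finally show ?thesis
      using True assms(1) by (simp add: C_gf_compose_nth RH_gf_compose_nth case_prod_unfold)
  next
    case False
    then show ?thesis by (simp add: C_gf_compose_nth RH_gf_compose_nth)
  qed
  finally show "(RH_gf b (r ^ b) oo (of_nat b * zvar)) $ n $ l =
      (scalar (1 / of_nat b) * (\<Sum>d<b. (C_gf b (c ^ d * r) oo (of_nat b * zvar)) *
        (\<Sum>p<b. scalar ((c ^ d * r) powi (- int p))))) $ n $ l" ..
qed

section \<open>The root of unity in the coefficient field, and the two formulas\<close>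

lemma omega_power: "omega b ^ j = to_fract [:cis (2 * pi * real j / real b):]"
proof -
  have "exp (2 * of_real pi * \<i> / of_nat b) = cis (2 * pi / real b)"
    by (simp add: cis_conv_exp mult_ac)
  then have "omega b = to_fract [:cis (2 * pi / real b):]"
    by (simp add: omega_def)
  moreover have "to_fract x ^ j = to_fract (x ^ j)" for x :: "complex poly"
    by (induction j) simp_all
  ultimately show ?thesis
    by (simp add: poly_const_pow Complex.DeMoivre mult_ac)
qed

lemma omega_power_self: "b \<ge> 1 \<Longrightarrow> omega b ^ b = 1"
  by (simp add: omega_power one_pCons[symmetric])

lemma inj_on_omega_power:
  assumes "b \<ge> 1"
  shows "inj_on (\<lambda>j. omega b ^ j) {..<b}"
  using bij_betw_imp_inj_on[OF bij_betw_roots_unity[of b]] assms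
  by (simp add: omega_power inj_on_def)

theorem theorem9p1:
  fixes b :: nat and q :: "complex poly fract"
  assumes "b \<ge> 1" and "q \<noteq> 0"
  shows
    "(q \<noteq> 1 \<longrightarrow>
       C_gf b q oo (of_nat b * zvar) =
         (wvar ^ b * (lift_z (fps_exp (of_nat b)) - lift_z (fps_exp (of_nat b * q))))
           / ((1 - scalar q) * (scalar q ^ b - wvar ^ b * lift_z (fps_exp (of_nat b * q))))
         * ((\<Prod>j = 0..b - 1. scalar q
               - (lift_z tree_series oo (scalar (omega b ^ j) * zvar * wvar)) / zvar)
            / (\<Prod>j = 0..b - 1. 1
               - (lift_z tree_series oo (scalar (omega b ^ j) * zvar * wvar)) / zvar)))
     \<and>
     (\<forall>r. r ^ b = q \<longrightarrow>
       RH_gf b q oo (of_nat b * zvar) =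
         scalar (1 / of_nat b)
           * (\<Sum>d = 0..b - 1. (C_gf b (omega b ^ d * r) oo (of_nat b * zvar))
               * (\<Sum>p = 0..b - 1. scalar ((omega b ^ d * r) powi (- int p)))))"
proof -
  have range: "{0..b - 1} = {..<b}" using assms(1) by auto
  note omega = omega_power_self[OF assms(1)] inj_on_omega_power[OF assms(1)]
  show ?thesis
    unfolding range
  proof (intro conjI impI allI)
    assume "q \<noteq> 1"
    from C_gf_eq[OF assms this omega, unfolded tree_root_def] show
      "C_gf b q oo (of_nat b * zvar) =
         (wvar ^ b * (lift_z (fps_exp (of_nat b)) - lift_z (fps_exp (of_nat b * q))))
           / ((1 - scalar q) * (scalar q ^ b - wvar ^ b * lift_z (fps_exp (of_nat b * q))))
         * ((\<Prod>j<b. scalar q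
               - (lift_z tree_series oo (scalar (omega b ^ j) * zvar * wvar)) / zvar)
            / (\<Prod>j<b. 1
               - (lift_z tree_series oo (scalar (omega b ^ j) * zvar * wvar)) / zvar))" .
  next
    fix r assume r: "r ^ b = q"
    then have "r \<noteq> 0" using assms by (auto simp: power_0_left)
    from RH_gf_eq[OF assms(1) omega this] show "RH_gf b q oo (of_nat b * zvar) =
         scalar (1 / of_nat b)
           * (\<Sum>d<b. (C_gf b (omega b ^ d * r) oo (of_nat b * zvar))
               * (\<Sum>p<b. scalar ((omega b ^ d * r) powi (- int p))))"
      unfolding r .
  qed
qed

end
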